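(* Let $n\ge 1$ and let $\xi:\mathcal{F}(\Delta^n)\to\mathbb{Z}^{n+1}$ be a hyper characteristic function on the $n$-simplex $\Delta^n$. Then the quotient space $L(\Delta^n,\xi)$ is a $(2n+1)$-dimensional topological manifold, and the $T^{n+1}$-action on it induced from the group operation on the first factor of $T^{n+1}\times\Delta^n$ is effective. Furthermore: (1) if the rank of $\mathbb{Z}(\Delta^n,\xi)$ is $n$, then $L(\Delta^n,\xi)$ is homeomorphic to $S^1\times\mathbb{CP}^n$; (2) if the rank of $\mathbb{Z}(\Delta^n,\xi)$ is $n+1$, then $L(\Delta^n,\xi)$ is homeomorphic to the orbit space $S^{2n+1}/\mathbb{Z}_\xi(\Delta^n)$. In particular, if $\{\xi_0,\ldots,\xi_n\}$ is a basis of $\mathbb{Z}^{n+1}$, then $L(\Delta^n,\xi)$ is homeomorphic to $S^{2n+1}$.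
   Context: $\Delta^n$ is the $n$-simplex with vertices $V_0,\dots,V_n$; $F_i$ is the facet not containing $V_i$; $\mathcal{F}(\Delta^n)=\{F_0,\dots,F_n\}$. A function $\xi:\mathcal{F}(\Delta^n)\to\mathbb{Z}^{n+1}$, with $\xi_i:=\xi(F_i)$, is a hyper characteristic function if whenever $F_{i_1}\cap\dots\cap F_{i_\ell}\neq\emptyset$ (for distinct indices), the submodule generated by $\xi_{i_1},\dots,\xi_{i_\ell}$ is a direct summand of $\mathbb{Z}^{n+1}$ of rank $\ell$. $T^{n+1}=\mathbb{R}^{n+1}/\mathbb{Z}^{n+1}$; a direct summand $N\subset\mathbb{Z}^{n+1}$ corresponds to the torus subgroup given by the image of $N\otimes\mathbb{R}$. For a face $F=F_{i_1}\cap\dots\cap F_{i_\ell}$ of codimension $\ell$, $T_F\subset T^{n+1}$ is the torus subgroup corresponding to the submodule generated by $\xi_{i_1},\dots,\xi_{i_\ell}$; and $T_{\Delta^n}=1$. Define $L(\Delta^n,\xi)=(T^{n+1}\times\Delta^n)/\sim$, where $(t,x)\sim(u,y)$ iff $x=y$ and $tu^{-1}\in T_F$, with $F$ the unique face containing $x$ in its relative interior. $\mathbb{Z}(\Delta^n,\xi)\subset\mathbb{Z}^{n+1}$ is the submodule generated by $\xi_0,\dots,\xi_n$ (its rank is $n$ or $n+1$), and $\mathbb{Z}_\xi(\Delta^n)=\mathbb{Z}^{n+1}/\mathbb{Z}(\Delta^n,\xi)$. When the rank is $n+1$, the finite group $\mathbb{Z}_\xi(\Delta^n)$ acts on $S^{2n+1}\subset\mathbb{C}^{n+1}$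 as follows: it is the kernel of the surjection $\mathbb{R}^{n+1}/\mathbb{Z}(\Delta^n,\xi)\to\mathbb{R}^{n+1}/\mathbb{Z}^{n+1}$, and $\mathbb{R}^{n+1}/\mathbb{Z}(\Delta^n,\xi)$ is identified with the standard torus $(S^1)^{n+1}$ via the basis $\xi_0,\dots,\xi_n$, which acts coordinatewise on $S^{2n+1}$. Explicitly, the class of $v=\sum_i x_i\xi_i\in\mathbb{Z}^{n+1}$ ($x_i\in\mathbb{Q}$) sends $(z_1,\dots,z_{n+1})$ to $(e^{2\pi\sqrt{-1}x_0}z_1,\dots,e^{2\pi\sqrt{-1}x_n}z_{n+1})$. *)

theory Defs
  imports "HOL-Analysis.Analysis" "HOL-Algebra.Group_Action"
begin

section \<open>Topological preliminaries\<close>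

text \<open>The quotient topology on the image of \<open>f\<close>; identifying points along an equivalence
  relation means taking for \<open>f\<close> the map to equivalence classes.\<close>

definition quotient_topology :: "'a topology \<Rightarrow> ('a \<Rightarrow> 'b) \<Rightarrow> 'b topology" where
  "quotient_topology X f =
     topology (\<lambda>U. U \<subseteq> f ` topspace X \<and> openin X {x \<in> topspace X. f x \<in> U})"

lemma openin_quotient_topology:
  "openin (quotient_topology X f) U \<longleftrightarrow>
     U \<subseteq> f ` topspace X \<and> openin X {x \<in> topspace X. f x \<in> U}"
proof -
  have "istopology (\<lambda>U. U \<subseteq> f ` topspace X \<and> openin X {x \<in> topspace X. f x \<in> U})"
    unfolding istopology_def
  proof (rule conjI; intro allI impI)
    fix S T
    assume "S \<subseteq> f ` topspace X \<and> openin X {x \<in> topspace X. f x \<in> S}"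
      and "T \<subseteq> f ` topspace X \<and> openin X {x \<in> topspace X. f x \<in> T}"
    moreover have "{x \<in> topspace X. f x \<in> S \<inter> T} =
      {x \<in> topspace X. f x \<in> S} \<inter> {x \<in> topspace X. f x \<in> T}" by blast
    ultimately show "S \<inter> T \<subseteq> f ` topspace X \<and> openin X {x \<in> topspace X. f x \<in> S \<inter> T}"
      by (simp only: openin_Int le_infI1 simp_thms)
  next
    fix \<K>
    assume K: "\<forall>K\<in>\<K>. K \<subseteq> f ` topspace X \<and> openin X {x \<in> topspace X. f x \<in> K}"
    have "{x \<in> topspace X. f x \<in> \<Union>\<K>} = (\<Union>K\<in>\<K>. {x \<in> topspace X. f x \<in> K})" by blast
    then show "\<Union>\<K> \<subseteq> f ` topspace X \<and> openin X {x \<in> topspace X. f x \<in> \<Union>\<K>}"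
      using K by (auto intro!: openin_Union)
  qed
  then show ?thesis
    by (simp add: quotient_topology_def topology_inverse')
qed

lemma topspace_quotient_topology [simp]:
  "topspace (quotient_topology X f) = f ` topspace X"
proof (rule subset_antisym)
  show "topspace (quotient_topology X f) \<subseteq> f ` topspace X"
    using openin_topspace[of "quotient_topology X f"] unfolding openin_quotient_topology
    by (rule conjunct1)
  have "{x \<in> topspace X. f x \<in> f ` topspace X} = topspace X" by blast
  then have "openin (quotient_topology X f) (f ` topspace X)"
    unfolding openin_quotient_topology by simp
  then show "f ` topspace X \<subseteq> topspace (quotient_topology X f)"
    by (rule openin_subset)
qed

lemma quotient_map_quotient_topology: "quotient_map X (quotient_topology X f) f"
  unfolding quotient_map_def openin_quotient_topology by simp

definition orbit_space ::
    "('g, 'm) monoid_scheme \<Rightarrow> 'a topology \<Rightarrow> ('g \<Rightarrow> 'a \<Rightarrow> 'a) \<Rightarrow> 'a set topology" where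
  "orbit_space G X \<phi> = quotient_topology X (orbit G \<phi>)"

definition topological_manifold :: "nat \<Rightarrow> 'a topology \<Rightarrow> bool" where
  "topological_manifold m X \<longleftrightarrow>
     Hausdorff_space X \<and> second_countable X \<and>
     (\<forall>p \<in> topspace X. \<exists>U V. openin X U \<and> p \<in> U \<and> openin (Euclidean_space m) V \<and>
        subtopology X U homeomorphic_space subtopology (Euclidean_space m) V)"

text \<open>If \<open>'n\<close> has \<open>n + 1\<close> elements, this is \<open>n\<close>-dimensional complex projective space.\<close>

definition complex_projective_space :: "(complex^'n) set topology" where
  "complex_projective_space =
     quotient_topology (top_of_set (- {0})) (\<lambda>z. {c *s z | c. c \<noteq> 0})"


section \<open>The lattice of integer vectors\<close>

interpretation int_vec: module "(*s) :: int \<Rightarrow> int^'n \<Rightarrow> int^'n"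
  by unfold_locales (vector algebra_simps)+

text \<open>The rank \<open>r\<close> is unique when it exists, and it exists for every submodule, since
  submodules of a finitely generated free abelian group are again free.\<close>

definition has_rank :: "(int^'n) set \<Rightarrow> nat \<Rightarrow> bool" where
  "has_rank N r \<longleftrightarrow>
     (\<exists>B. finite B \<and> card B = r \<and> int_vec.independent B \<and> int_vec.span B = N)"

definition direct_summand :: "(int^'n) set \<Rightarrow> bool" where
  "direct_summand N \<longleftrightarrow> int_vec.subspace N \<and>
     (\<exists>M. int_vec.subspace M \<and> N \<inter> M = {0} \<and> {a + b | a b. a \<in> N \<and> b \<in> M} = UNIV)"

definition is_basis :: "(int^'n) set \<Rightarrow> bool" where
  "is_basis B \<longleftrightarrow> int_vec.independent B \<and> int_vec.span B = UNIV"

definition real_vec :: "int^'n \<Rightarrow> real^'n" where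
  "real_vec v = (\<chi> j. real_of_int (v $ j))"


section \<open>The simplex and hyper characteristic functions\<close>

text \<open>The vertices, and likewise the facets, of the \<open>n\<close>-simplex are indexed by a finite type
  \<open>'n\<close> with \<open>n + 1\<close> elements, which also indexes the coordinates of integer vectors. A function
  on facets is accordingly given by its values \<open>xi i\<close> on the facets \<open>facet i\<close>.\<close>

definition vertex :: "'n \<Rightarrow> real^'n" where
  "vertex i = axis i 1"

definition std_simplex :: "(real^'n) set" where
  "std_simplex = convex hull (range vertex)"

definition facet :: "'n \<Rightarrow> (real^'n) set" where
  "facet i = convex hull (vertex ` (- {i}))"

text \<open>The intersection with \<open>std_simplex\<close> only matters for \<open>I = {}\<close>.\<close>

definition simplex_face :: "'n set \<Rightarrow> (real^'n) set" where
  "simplex_face I = std_simplex \<inter> (\<Inter>i\<in>I. facet i)"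

definition hyper_characteristic :: "('n \<Rightarrow> int^'n) \<Rightarrow> bool" where
  "hyper_characteristic xi \<longleftrightarrow>
     (\<forall>I. simplex_face I \<noteq> {} \<longrightarrow>
        direct_summand (int_vec.span (xi ` I)) \<and> has_rank (int_vec.span (xi ` I)) (card I))"


section \<open>The torus and the space \<open>L\<close>\<close>

definition additive_group :: "'a::ab_group_add monoid" where
  "additive_group = \<lparr>carrier = UNIV, monoid.mult = (+), one = 0\<rparr>"

definition torus_group :: "(real^'n) set monoid" where
  "torus_group = additive_group Mod (range real_vec)"

definition torus_proj :: "real^'n \<Rightarrow> (real^'n) set" where
  "torus_proj x = range real_vec #>\<^bsub>additive_group\<^esub> x"

definition torus :: "(real^'n) set topology" where
  "torus = quotient_topology euclidean torus_proj"

text \<open>Here \<open>span\<close> is the real span, that is, the image of \<open>N \<otimes> \<real>\<close> in Euclidean space.\<close>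

definition torus_subgroup :: "(int^'n) set \<Rightarrow> (real^'n) set set" where
  "torus_subgroup N = torus_proj ` span (real_vec ` N)"

text \<open>Distinct index sets \<open>I\<close> with nonempty \<open>simplex_face I\<close> give distinct faces, so the
  existential quantifier below picks out the unique face with \<open>x\<close> in its relative interior.\<close>

definition L_rel ::
    "('n \<Rightarrow> int^'n) \<Rightarrow> (((real^'n) set \<times> (real^'n)) \<times> ((real^'n) set \<times> (real^'n))) set" where
  "L_rel xi = {((t, x), (u, y)).
      t \<in> carrier torus_group \<and> u \<in> carrier torus_group \<and> x \<in> std_simplex \<and> x = y \<and>
      (\<exists>I. x \<in> rel_interior (simplex_face I) \<and>
         t \<otimes>\<^bsub>torus_group\<^esub> inv\<^bsub>torus_group\<^esub> u \<in> torus_subgroup (int_vec.span (xi ` I)))}"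

definition L_space :: "('n \<Rightarrow> int^'n) \<Rightarrow> ((real^'n) set \<times> (real^'n)) set topology" where
  "L_space xi =
     quotient_topology (prod_topology torus (top_of_set std_simplex)) (\<lambda>p. L_rel xi `` {p})"

text \<open>The class of \<open>(s, x)\<close> is sent to the class of \<open>(t s, x)\<close>, written as the image of the
  class under translation of the first factor. The restriction makes the maps extensional, as
  required by \<^const>\<open>BijGroup\<close>.\<close>

definition torus_action ::
    "('n \<Rightarrow> int^'n) \<Rightarrow> (real^'n) set \<Rightarrow>
     ((real^'n) set \<times> (real^'n)) set \<Rightarrow> ((real^'n) set \<times> (real^'n)) set" where
  "torus_action xi t =
     (\<lambda>C \<in> topspace (L_space xi). (\<lambda>(s, x). (t \<otimes>\<^bsub>torus_group\<^esub> s, x)) ` C)"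


section \<open>The group acting on the sphere\<close>

definition quotient_lattice :: "('n \<Rightarrow> int^'n) \<Rightarrow> (int^'n) set monoid" where
  "quotient_lattice xi = additive_group Mod (int_vec.span (range xi))"

text \<open>Only meaningful when the \<open>xi i\<close> are linearly independent: then the coordinates \<open>x\<close> of \<open>v\<close>
  are unique (and rational), and changing the representative \<open>v\<close> of the class \<open>C\<close> changes them by
  integers, so the image point \<open>w\<close> is uniquely determined.\<close>

definition sphere_action :: "('n \<Rightarrow> int^'n) \<Rightarrow> (int^'n) set \<Rightarrow> complex^'n \<Rightarrow> complex^'n" where
  "sphere_action xi C =
     (\<lambda>z \<in> sphere 0 1. THE w. \<exists>v \<in> C. \<exists>x :: real^'n.
        real_vec v = (\<Sum>i\<in>UNIV. (x $ i) *\<^sub>R real_vec (xi i)) \<and>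
        w = (\<chi> i. cis (2 * pi * (x $ i)) * z $ i))"

end

theory Submission
  imports Defs
begin

text \<open>The fibre of \<open>L\<close> over a point \<open>x\<close> of the simplex is the torus divided by the subtorus spanned by
  those \<open>xi i\<close> for which the barycentric coordinate \<open>x $ i\<close> vanishes. The unit sphere of
  \<open>\<complex>\<^sup>n\<^sup>+\<^sup>1\<close> has the same structure: writing \<open>z $ i\<close> in polar coordinates as
  \<open>sqrt (x $ i) * cis (2 * pi * a $ i)\<close>, the angle \<open>a $ i\<close> is lost exactly if \<open>x $ i = 0\<close>. So if
  vectors \<open>b i\<close> form a basis of the lattice, and \<open>b i = xi i\<close> whenever \<open>x $ i = 0\<close>, then the class
  in \<open>L\<close> of the pair of \<open>\<Sum>i. a $ i * b i\<close> and \<open>x\<close> and the point of the sphere with polar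
  coordinates \<open>a\<close>, \<open>x\<close> determine each other (\<open>L_class_polar_same_kernel\<close>). Both depend on \<open>(a, x)\<close>
  through quotient maps, so the homeomorphisms follow from comparing fibres
  (\<open>homeomorphic_quotients\<close>).

  If the \<open>xi i\<close> form a basis, this applies to all \<open>x\<close>, and \<open>L\<close> is the sphere. If they are
  merely linearly independent, the coordinates \<open>a\<close> of a point of the torus are determined up to those
  of integer vectors, and these act on the sphere as the group of the quotient lattice does
  (\<open>L_homeomorphic_sphere_orbit_space\<close>).

  In general, the \<open>xi i\<close> with \<open>i \<noteq> j\<close> generate a direct summand whose complement is cyclic, so they
  can be completed to a basis. Hence the open part of \<open>L\<close> where \<open>x $ j \<noteq> 0\<close> is homeomorphic to
  the part of the sphere where \<open>z $ j \<noteq> 0\<close> (\<open>L_chart_homeomorphic_sphere_part\<close>), and \<open>L\<close> is a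
  manifold. The torus acts effectively since it acts freely over the barycentre.

  In rank \<open>n\<close>, there is one relation between the \<open>xi i\<close>. Each \<open>xi i\<close> is an integer combination
  of the others, so the coefficients of the relation are \<open>\<plusminus> 1\<close> after scaling (\<open>relation_signs\<close>).
  After the corresponding changes of sign, the \<open>xi i\<close> add up to zero, so simultaneous rotation of the
  coordinates of the sphere becomes trivial in \<open>L\<close>, which leaves projective space; a vector
  completing the lattice contributes the circle (\<open>L_homeomorphic_circle_projective\<close>).

  The required facts on the lattice are proved in real space. The link is an additive map from \<open>\<real>\<close>
  to \<open>\<rat>\<close> fixing \<open>1\<close>, which turns real relations between integer vectors into rational ones
  (\<open>int_relation_if_real_relation\<close>).\<close>


section \<open>Quotient maps and countability\<close>

text \<open>The homeomorphisms between \<open>L\<close> and the model spaces come from pairs of quotient maps on a common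
  parameter space that have the same fibres.\<close>

lemma homeomorphic_quotients:
  assumes f: "quotient_map X Y f" and g: "quotient_map X Z g"
    and ker: "\<And>x y. x \<in> topspace X \<Longrightarrow> y \<in> topspace X \<Longrightarrow> f x = f y \<longleftrightarrow> g x = g y"
  shows "Y homeomorphic_space Z"
proof -
  obtain h where h: "continuous_map Y Z h" "\<And>x. x \<in> topspace X \<Longrightarrow> h (f x) = g x"
    using quotient_map_lift_exists[OF f quotient_imp_continuous_map[OF g]] ker by metis
  obtain k where k: "continuous_map Z Y k" "\<And>x. x \<in> topspace X \<Longrightarrow> k (g x) = f x"
    using quotient_map_lift_exists[OF g quotient_imp_continuous_map[OF f]] ker by metis
  have "homeomorphic_maps Y Z h k"
    unfolding homeomorphic_maps_def
    using h k quotient_imp_surjective_map[OF f, symmetric] quotient_imp_surjective_map[OF g, symmetric]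
    by auto
  then show ?thesis
    by (auto simp: homeomorphic_space_def)
qed

text \<open>The parameter spaces are not compact, but a compact part of them already covers the target.\<close>

lemma quotient_map_if_compact_surj:
  assumes f: "continuous_map X Y f" and K: "compactin X K" "f ` K = topspace Y" and "Hausdorff_space Y"
  shows "quotient_map X Y f"
proof (rule quotient_map_from_composition[OF _ f])
  show "continuous_map (subtopology X K) X id"
    by (simp add: continuous_map_from_subtopology id_def)
  have "K \<subseteq> topspace X"
    using K(1) by (rule compactin_subset_topspace)
  have "quotient_map (subtopology X K) Y f"
  proof (rule continuous_imp_quotient_map)
    show "continuous_map (subtopology X K) Y f"
      using f by (rule continuous_map_from_subtopology)
    show "compact_space (subtopology X K)"
      using K(1) by (rule compact_space_subtopology)
    show "f ` topspace (subtopology X K) = topspace Y"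
      using K(2) \<open>K \<subseteq> topspace X\<close> by (simp add: inf_absorb2)
  qed fact
  then show "quotient_map (subtopology X K) Y (f \<circ> id)" by simp
qed

lemma homeomorphic_imp_homeomorphic_space:
  assumes "S homeomorphic T"
  shows "top_of_set S homeomorphic_space top_of_set T"
proof -
  obtain f g where "homeomorphism S T f g"
    using assms by (auto simp: homeomorphic_def)
  then have "homeomorphic_maps (top_of_set S) (top_of_set T) f g"
    by (auto simp: homeomorphism_def homeomorphic_maps_def continuous_map_in_subtopology)
  then show ?thesis
    by (auto simp: homeomorphic_space_def)
qed

lemma openin_homeomorphic_image:
  assumes "X homeomorphic_space Y" "openin X U"
  obtains V where "openin Y V" "subtopology X U homeomorphic_space subtopology Y V"
proof -
  obtain f where f: "homeomorphic_map X Y f"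
    using assms(1) by (auto simp: homeomorphic_space)
  have "openin Y (f ` U)"
    using f assms(2) by (metis homeomorphic_map_openness_eq)
  moreover have "homeomorphic_map (subtopology X U) (subtopology Y (f ` U)) f"
    by (rule homeomorphic_map_subtopologies_alt[OF f])
      (use homeomorphic_imp_injective_map[OF f] openin_subset[OF assms(2)] in \<open>auto dest: inj_onD\<close>)
  then have "subtopology X U homeomorphic_space subtopology Y (f ` U)"
    by (auto simp: homeomorphic_space)
  ultimately show thesis using that by blast
qed

lemma second_countable_top_of_set: "second_countable (top_of_set (S :: 'a::euclidean_space set))"
proof (rule second_countable_subtopology)
  obtain B :: "'a set set" where B: "countable B" "topological_basis B"
    using ex_countable_basis by blast
  show "second_countable (euclidean :: 'a topology)"
    unfolding second_countable_def
  proof (intro exI[of _ B] conjI ballI allI impI)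
    show "openin euclidean V" if "V \<in> B" for V
      using topological_basis_open[OF B(2) that] by simp
    show "\<exists>V\<in>B. x \<in> V \<and> V \<subseteq> W" if "openin euclidean W \<and> x \<in> W" for W x
      using topological_basisE[OF B(2), of W x] that by auto
  qed (rule B(1))
qed

lemma second_countable_finite_open_cover:
  assumes cover: "topspace X = (\<Union>j\<in>J. U j)" and "finite J" and "\<And>j. j \<in> J \<Longrightarrow> openin X (U j)"
    and "\<And>j. j \<in> J \<Longrightarrow> second_countable (subtopology X (U j))"
  shows "second_countable X"
proof -
  have "\<forall>j\<in>J. \<exists>B. countable B \<and> (\<forall>V\<in>B. openin X V) \<and>
      (\<forall>W x. openin X W \<and> x \<in> W \<and> x \<in> U j \<longrightarrow> (\<exists>V\<in>B. x \<in> V \<and> V \<subseteq> W))"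
  proof
    fix j assume j: "j \<in> J"
    obtain B where B: "countable B" "\<forall>V\<in>B. openin (subtopology X (U j)) V"
      "\<forall>W x. openin (subtopology X (U j)) W \<and> x \<in> W \<longrightarrow> (\<exists>V\<in>B. x \<in> V \<and> V \<subseteq> W)"
      using assms(4)[OF j] by (auto simp: second_countable_def)
    have nbhd: "\<exists>V\<in>B. x \<in> V \<and> V \<subseteq> W" if "openin X W" "x \<in> W" "x \<in> U j" for W x
    proof -
      have "openin (subtopology X (U j)) (U j \<inter> W)"
        using that(1) by (rule openin_subtopology_Int2)
      then show ?thesis using B(3) that by (metis IntI le_inf_iff)
    qed
    have "\<forall>V\<in>B. openin X V"
      using B(2) openin_trans_full[OF _ assms(3)[OF j]] by blast
    then show "\<exists>B. countable B \<and> (\<forall>V\<in>B. openin X V) \<and>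
      (\<forall>W x. openin X W \<and> x \<in> W \<and> x \<in> U j \<longrightarrow> (\<exists>V\<in>B. x \<in> V \<and> V \<subseteq> W))"
      using B(1) nbhd by (intro exI[of _ B]) blast
  qed
  from bchoice[OF this] obtain B where B_all: "\<forall>j\<in>J. countable (B j) \<and> (\<forall>V\<in>B j. openin X V) \<and>
      (\<forall>W x. openin X W \<and> x \<in> W \<and> x \<in> U j \<longrightarrow> (\<exists>V\<in>B j. x \<in> V \<and> V \<subseteq> W))"
    by blast
  then have B: "\<And>j. j \<in> J \<Longrightarrow> countable (B j)" "\<And>j V. j \<in> J \<Longrightarrow> V \<in> B j \<Longrightarrow> openin X V"
    "\<And>j W x. j \<in> J \<Longrightarrow> openin X W \<Longrightarrow> x \<in> W \<Longrightarrow> x \<in> U j \<Longrightarrow> \<exists>V\<in>B j. x \<in> V \<and> V \<subseteq> W"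
    by simp_all
  show ?thesis
    unfolding second_countable_def
  proof (intro exI[of _ "\<Union>j\<in>J. B j"] conjI allI impI ballI)
    show "countable (\<Union>j\<in>J. B j)"
      using B(1) countable_finite[OF \<open>finite J\<close>] by (intro countable_UN)
  next
    fix W x assume W: "openin X W \<and> x \<in> W"
    then obtain j where j: "j \<in> J" "x \<in> U j"
      using openin_subset cover by blast
    then obtain V where "V \<in> B j" "x \<in> V" "V \<subseteq> W"
      using B(3)[OF j(1) _ _ j(2)] W by auto
    then show "\<exists>V\<in>\<Union>j\<in>J. B j. x \<in> V \<and> V \<subseteq> W"
      using j(1) by auto
  next
    fix V assume "V \<in> (\<Union>j\<in>J. B j)"
    then show "openin X V" using B(2) by auto
  qed
qed


section \<open>Integer vectors inside real space\<close>

lemma real_vec_nth [simp]: "real_vec v $ j = real_of_int (v $ j)"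
  by (simp add: real_vec_def)

lemma real_vec_0 [simp]: "real_vec 0 = 0"
  by (simp add: vec_eq_iff)

lemma real_vec_add: "real_vec (v + w) = real_vec v + real_vec w"
  by (simp add: vec_eq_iff)

lemma real_vec_uminus: "real_vec (- v) = - real_vec v"
  by (simp add: vec_eq_iff)

lemma real_vec_diff: "real_vec (v - w) = real_vec v - real_vec w"
  by (simp add: vec_eq_iff)

lemma real_vec_smult: "real_vec (k *s v) = real_of_int k *\<^sub>R real_vec v"
  by (simp add: vec_eq_iff)

lemma real_vec_sum: "real_vec (\<Sum>i\<in>S. g i) = (\<Sum>i\<in>S. real_vec (g i))"
  by (simp add: vec_eq_iff)

lemma inj_real_vec: "inj real_vec"
  by (auto simp: inj_def vec_eq_iff)

lemma real_vec_eq_iff [simp]: "real_vec v = real_vec w \<longleftrightarrow> v = w"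
  using inj_real_vec by (auto dest: injD)

text \<open>Extend \<open>1\<close> to a basis of \<open>\<real>\<close> over \<open>\<rat>\<close> and take the coordinate at \<open>1\<close>.\<close>

lemma exists_additive_real_to_rat:
  "\<exists>f :: real \<Rightarrow> rat. (\<forall>x y. f (x + y) = f x + f y) \<and> f 1 = 1"
proof -
  interpret p: vector_space_pair "\<lambda>q x. of_rat q * x :: real" "\<lambda>q x. q * x :: rat"
    by unfold_locales (auto simp: algebra_simps of_rat_add of_rat_mult)
  have "p.vs1.independent {1}"
    by (auto simp: p.vs1.dependent_finite)
  then obtain f where f: "Vector_Spaces.linear (\<lambda>q x. of_rat q * x) (\<lambda>q x. q * x) f"
      and "f (1::real) = (1::rat)"
    using p.linear_independent_extend[of "{1}" "\<lambda>_. 1"] by auto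
  then show ?thesis
    using p.linear_add[OF f] by blast
qed

lemma clear_denominators:
  fixes q :: "'i \<Rightarrow> rat"
  assumes "finite S"
  obtains d :: int and k :: "'i \<Rightarrow> int"
  where "d > 0" "\<And>i. i \<in> S \<Longrightarrow> of_int d * q i = of_int (k i)"
proof -
  have "\<exists>d>0::int. \<forall>i\<in>S. \<exists>k::int. of_int d * q i = of_int k"
    using assms
  proof induction
    case empty
    show ?case by (auto intro: exI[of _ 1])
  next
    case (insert i S)
    then obtain d :: int where d: "d > 0" "\<And>j. j \<in> S \<Longrightarrow> \<exists>k::int. of_int d * q j = of_int k"
      by blast
    obtain a b :: int where ab: "b > 0" "q i = of_int a / of_int b"
      by (metis quotient_of_div quotient_of_denom_pos surj_pair)
    have "\<exists>k::int. of_int (d * b) * q j = of_int k" if j: "j \<in> insert i S" for j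
    proof (cases "j = i")
      case True
      have "of_int (d * b) * q i = of_int (d * a)"
        using ab by simp
      then show ?thesis using True by blast
    next
      case False
      then obtain k :: int where k: "of_int d * q j = of_int k"
        using d(2)[of j] j by blast
      have "of_int (d * b) * q j = of_int b * (of_int d * q j)"
        by simp
      then have "of_int (d * b) * q j = of_int (b * k)"
        by (simp only: k of_int_mult)
      then show ?thesis by blast
    qed
    then show ?case
      using d(1) ab(1) by (intro exI[of _ "d * b"]) auto
  qed
  then show ?thesis
    using that by metis
qed

text \<open>An additive map from the reals to the rationals commutes with multiplication by integers.
  Applied to the coefficients of a real relation between integer vectors, it therefore gives a
  rational relation; normalising the coefficient at \<open>j\<close> to \<open>1\<close> beforehand keeps it nonzero. This
  is what allows ranks and divisibility in the lattice to be read off in real space.\<close>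

lemma int_relation_if_real_relation:
  fixes g :: "'i \<Rightarrow> int^'n::finite"
  assumes "finite S" and rel: "(\<Sum>i\<in>S. c i *\<^sub>R real_vec (g i)) = 0"
    and "j \<in> S" "c j \<noteq> 0"
  obtains k :: "'i \<Rightarrow> int" where "(\<Sum>i\<in>S. k i *s g i) = 0" "k j \<noteq> 0"
proof -
  obtain f :: "real \<Rightarrow> rat" where add: "\<And>x y. f (x + y) = f x + f y" and "f 1 = 1"
    using exists_additive_real_to_rat by blast
  interpret f: additive f
    by unfold_locales (rule add)
  have mult_nat: "f (of_nat m * x) = of_nat m * f x" for m x
    by (induction m) (auto simp: algebra_simps add f.zero)
  have mult_int: "f (x * of_int m) = of_int m * f x" for m x
    using mult_nat[of _ x] by (cases m rule: int_cases2) (auto simp: f.minus mult.commute)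
  define q where "q i = f (c i / c j)" for i
  have q_rel: "(\<Sum>i\<in>S. q i * of_int (g i $ m)) = 0" for m
  proof -
    have "(\<Sum>i\<in>S. (c i / c j) * of_int (g i $ m)) = (\<Sum>i\<in>S. c i *\<^sub>R real_vec (g i)) $ m / c j"
      by (simp add: sum_divide_distrib)
    also have "\<dots> = 0" by (simp only: rel) simp
    finally have "f (\<Sum>i\<in>S. (c i / c j) * of_int (g i $ m)) = 0"
      by (simp add: f.zero)
    then show ?thesis
      by (simp only: f.sum mult_int q_def mult.commute[of "f _"])
  qed
  obtain d k where d: "(d::int) > 0" and k: "\<And>i. i \<in> S \<Longrightarrow> of_int d * q i = of_int (k i)"
    using clear_denominators[OF assms(1)] by blast
  show thesis
  proof (rule that[of k])
    have "of_int (\<Sum>i\<in>S. k i * g i $ m) = (0::rat)" for m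
    proof -
      have "of_int (\<Sum>i\<in>S. k i * g i $ m) = of_int d * (\<Sum>i\<in>S. q i * of_int (g i $ m))"
        by (simp add: sum_distrib_left k mult.assoc[symmetric])
      then show ?thesis by (simp add: q_rel)
    qed
    then show "(\<Sum>i\<in>S. k i *s g i) = 0"
      by (simp only: of_int_eq_0_iff) (simp add: vec_eq_iff)
    show "k j \<noteq> 0"
      using k[OF assms(3)] d \<open>f 1 = 1\<close> assms(4) by (auto simp: q_def)
  qed
qed

lemma independent_real_vec:
  assumes "finite B" "int_vec.independent (B :: (int^'n::finite) set)"
  shows "independent (real_vec ` B)"
proof (rule ccontr)
  assume "\<not> independent (real_vec ` B)"
  then obtain u w where w: "w \<in> B" "u (real_vec w) \<noteq> 0"
    and u: "(\<Sum>v\<in>real_vec ` B. u v *\<^sub>R v) = 0"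
    using assms(1) by (auto simp: dependent_finite)
  have "(\<Sum>v\<in>B. u (real_vec v) *\<^sub>R real_vec v) = 0"
    using u by (subst (asm) sum.reindex) (auto intro: inj_on_subset[OF inj_real_vec])
  then obtain k :: "int^'n \<Rightarrow> int" where "(\<Sum>v\<in>B. k v *s v) = 0" "k w \<noteq> 0"
    using int_relation_if_real_relation[of B "\<lambda>v. u (real_vec v)" "\<lambda>v. v" w] assms(1) w by auto
  then show False
    using assms w(1) by (auto simp: int_vec.dependent_finite)
qed

lemma span_real_vec_int_span:
  "span (real_vec ` int_vec.span S) = span (real_vec ` S)"
  unfolding span_eq
proof
  show "real_vec ` int_vec.span S \<subseteq> span (real_vec ` S)"
  proof (rule image_subsetI)
    fix v assume "v \<in> int_vec.span S"
    then show "real_vec v \<in> span (real_vec ` S)"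
      by (induction rule: int_vec.span_induct_alt)
        (auto simp: real_vec_add real_vec_smult span_zero intro!: span_add span_scale[OF span_base])
  qed
  show "real_vec ` S \<subseteq> span (real_vec ` int_vec.span S)"
    by (auto intro!: span_base int_vec.span_base)
qed

lemma has_rank_imp_dim:
  assumes "has_rank (N :: (int^'n::finite) set) r"
  shows "dim (real_vec ` N) = r"
proof -
  obtain B where B: "finite B" "card B = r" "int_vec.independent B" "int_vec.span B = N"
    using assms by (auto simp: has_rank_def)
  have "dim (real_vec ` N) = dim (real_vec ` B)"
    using B(4) by (metis dim_span span_real_vec_int_span)
  also have "\<dots> = card (real_vec ` B)"
    using independent_real_vec[OF B(1,3)] by (simp add: dim_eq_card_independent)
  also have "\<dots> = r"
    using B(2) by (simp add: card_image inj_on_subset[OF inj_real_vec])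
  finally show ?thesis .
qed

text \<open>A generating family whose size equals the rank has no repetitions and no relations: the real
  span has dimension \<open>card I\<close>. The family is indexed because \<open>xi\<close> is not known to be injective.\<close>

lemma relation_trivial_if_full_rank:
  fixes xi :: "'i \<Rightarrow> int^'n::finite"
  assumes "finite I" "has_rank (int_vec.span (xi ` I)) (card I)"
    and rel: "(\<Sum>i\<in>I. c i *\<^sub>R real_vec (xi i)) = 0" and "j \<in> I"
  shows "c j = 0"
proof -
  let ?f = "\<lambda>i. real_vec (xi i)"
  have "dim (real_vec ` int_vec.span (xi ` I)) = card I"
    using assms(2) by (rule has_rank_imp_dim)
  then have dim: "dim (?f ` I) = card I"
    by (metis dim_span image_image span_real_vec_int_span)
  then have card: "card (?f ` I) = card I"
    using dim_le_card'[of "?f ` I"] card_image_le[OF assms(1), of ?f] assms(1) by simp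
  then have inj: "inj_on ?f I"
    using assms(1) by (simp add: eq_card_imp_inj_on)
  have "independent (?f ` I)"
    by (rule card_le_dim_spanning[of _ "?f ` I"]) (use assms(1) dim card in \<open>auto simp: span_superset\<close>)
  define u where "u v = c (the_inv_into I ?f v)" for v
  have "(\<Sum>v\<in>?f ` I. u v *\<^sub>R v) = (\<Sum>i\<in>I. c i *\<^sub>R ?f i)"
    by (subst sum.reindex[OF inj]) (auto intro!: sum.cong simp: u_def the_inv_into_f_f[OF inj])
  then have "u (?f j) = 0"
    using \<open>independent (?f ` I)\<close> assms(1) \<open>j \<in> I\<close> rel unfolding dependent_finite[OF finite_imageI[OF assms(1)]]
    by auto
  then show ?thesis
    by (simp add: u_def the_inv_into_f_f[OF inj \<open>j \<in> I\<close>])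
qed

text \<open>A real combination of elements of \<open>N\<close> equal to \<open>w\<close> yields an integer one equal to a multiple
  \<open>k w\<close> with \<open>k \<noteq> 0\<close>; the component of \<open>w\<close> in a complement of \<open>N\<close> is then killed by \<open>k\<close>, hence zero.\<close>

lemma direct_summand_saturated:
  assumes "direct_summand (N :: (int^'n::finite) set)" "real_vec w \<in> span (real_vec ` N)"
  shows "w \<in> N"
proof (rule ccontr)
  assume "w \<notin> N"
  obtain M where N: "int_vec.subspace N" and M: "int_vec.subspace M" "N \<inter> M = {0}"
      and NM: "{a + b | a b. a \<in> N \<and> b \<in> M} = UNIV"
    using assms(1) by (auto simp: direct_summand_def)
  obtain t u where t: "finite t" "t \<subseteq> real_vec ` N" and "real_vec w = (\<Sum>v\<in>t. u v *\<^sub>R v)"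
    using assms(2) by (auto simp: span_explicit)
  then obtain T where T: "finite T" "T \<subseteq> N" "t = real_vec ` T"
    by (meson finite_subset_image)
  have w: "real_vec w = (\<Sum>v\<in>T. u (real_vec v) *\<^sub>R real_vec v)"
    using \<open>real_vec w = _\<close> T(3) by (simp add: sum.reindex inj_on_subset[OF inj_real_vec])
  define c where "c v = (if v = w then -1 else u (real_vec v))" for v
  have "w \<notin> T" using T \<open>w \<notin> N\<close> by auto
  then have "(\<Sum>v\<in>T. c v *\<^sub>R real_vec v) = real_vec w"
    unfolding w by (intro sum.cong) (auto simp: c_def)
  then have "(\<Sum>v\<in>insert w T. c v *\<^sub>R real_vec v) = 0"
    using \<open>w \<notin> T\<close> T(1) by (simp add: c_def)
  then obtain k :: "int^'n \<Rightarrow> int" where "(\<Sum>v\<in>insert w T. k v *s v) = 0" and kw: "k w \<noteq> 0"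
    using int_relation_if_real_relation[of "insert w T" c "\<lambda>v. v" w] T(1) by (auto simp: c_def)
  then have "k w *s w = - (\<Sum>v\<in>T. k v *s v)"
    using \<open>w \<notin> T\<close> T(1) by (simp add: eq_neg_iff_add_eq_0)
  then have kwN: "k w *s w \<in> N"
    using N T(2) by (auto intro!: int_vec.subspace_neg int_vec.subspace_sum int_vec.subspace_scale)
  obtain a b where ab: "a \<in> N" "b \<in> M" "w = a + b"
    using NM by blast
  then have "k w *s b = k w *s w - k w *s a"
    by (simp add: int_vec.scale_right_distrib)
  then have "k w *s b \<in> N"
    using int_vec.subspace_diff[OF N kwN int_vec.subspace_scale[OF N ab(1)]] by simp
  then have "k w *s b \<in> N \<inter> M"
    using int_vec.subspace_scale[OF M(1) ab(2)] by blast
  then have "k w *s b = 0" using M by auto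
  then have "b = 0" using kw by (auto simp: vec_eq_iff)
  then show False using ab \<open>w \<notin> N\<close> by simp
qed


section \<open>Completing a facet lattice to the whole lattice\<close>

text \<open>An integral normal vector of \<open>N\<close> defines a homomorphism to \<open>\<int>\<close> that, by saturation, vanishes
  exactly on \<open>N\<close>. It embeds any complement of \<open>N\<close> into \<open>\<int>\<close>, so the complement is cyclic.\<close>

lemma direct_summand_complement_cyclic:
  fixes N :: "(int^'n::finite) set"
  assumes "direct_summand N" "dim (real_vec ` N) + 1 = CARD('n)"
  obtains b where "real_vec b \<notin> span (real_vec ` N)"
    "\<And>w. \<exists>a \<in> N. \<exists>k. w = a + k *s b"
proof -
  obtain M where N: "int_vec.subspace N" and M: "int_vec.subspace M" "N \<inter> M = {0}"
      and NM: "{a + b | a b. a \<in> N \<and> b \<in> M} = UNIV"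
    using assms(1) by (auto simp: direct_summand_def)
  have dim_less: "dim (real_vec ` N) < DIM(real^'n)"
    using assms(2) by simp
  \<comment> \<open>A vector normal to \<open>N\<close> is a linear relation between the rows of a matrix with columns
    spanning \<open>N\<close>, so it may be chosen to be integral.\<close>
  obtain S where S: "S \<subseteq> real_vec ` N" "independent S" "real_vec ` N \<subseteq> span S"
      "card S = dim (real_vec ` N)"
    using basis_exists by blast
  have "finite S"
    using S(2) by (rule independent_imp_finite)
  obtain x where "x \<noteq> 0" and x: "\<And>v. v \<in> span S \<Longrightarrow> orthogonal x v"
    using orthogonal_to_subspace_exists[of S] dim_less S by (metis dim_eq_card_independent)
  \<comment> \<open>The rows have at most as many entries as there are coordinates, so they fit into \<open>int^'n\<close>
    after padding with zeros; \<open>e\<close> numbers the columns.\<close>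
  have "card S \<le> CARD('n)"
    using S(4) assms(2) by simp
  then obtain e :: "(real^'n) \<Rightarrow> 'n" where e: "inj_on e S"
    using card_le_inj[OF \<open>finite S\<close>, of "UNIV :: 'n set"] by auto
  define g :: "'n \<Rightarrow> int^'n" where
    "g i = (\<chi> m. if m \<in> e ` S then \<lfloor>the_inv_into S e m $ i\<rfloor> else 0)" for i
  have g: "real_of_int (g i $ e s) = s $ i" if "s \<in> S" for i s
    using that S(1) by (auto simp: g_def the_inv_into_f_f[OF e])
  have g0: "g i $ m = 0" if "m \<notin> e ` S" for i m
    using that by (simp add: g_def)
  obtain i0 where "x $ i0 \<noteq> 0"
    using \<open>x \<noteq> 0\<close> by (auto simp: vec_eq_iff)
  have "(\<Sum>i\<in>UNIV. x $ i *\<^sub>R real_vec (g i)) = 0"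
  proof (rule vec_eq_iff[THEN iffD2], rule allI)
    fix m
    have "(\<Sum>i\<in>UNIV. x $ i * real_of_int (g i $ m)) = 0"
    proof (cases "m \<in> e ` S")
      case True
      then obtain s where s: "s \<in> S" "m = e s" by blast
      have "orthogonal x s" using x s(1) by (blast intro: span_base)
      then show ?thesis
        by (simp add: s(2) g[OF s(1)] orthogonal_def inner_vec_def)
    qed (simp add: g0)
    then show "(\<Sum>i\<in>UNIV. x $ i *\<^sub>R real_vec (g i)) $ m = 0 $ m"
      by simp
  qed
  then obtain k :: "'n \<Rightarrow> int" where k: "(\<Sum>i\<in>UNIV. k i *s g i) = 0" "k i0 \<noteq> 0"
    using int_relation_if_real_relation[of UNIV "\<lambda>i. x $ i" g i0] \<open>x $ i0 \<noteq> 0\<close> by auto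
  define phi :: "int^'n \<Rightarrow> int" where "phi v = (\<Sum>i\<in>UNIV. k i * v $ i)" for v
  have phi_add: "phi (v + w) = phi v + phi w" and phi_smult: "phi (c *s v) = c * phi v" for v w c
    by (simp_all add: phi_def algebra_simps sum.distrib sum_distrib_left)
  define a where "a = real_vec (\<chi> i. k i)"
  have phi_inner: "real_of_int (phi v) = a \<bullet> real_vec v" for v
    by (simp add: phi_def a_def inner_vec_def)
  have "a \<noteq> 0" using k(2) by (auto simp: a_def vec_eq_iff)
  have "a \<bullet> s = 0" if "s \<in> S" for s
  proof -
    have "real_of_int ((\<Sum>i\<in>UNIV. k i *s g i) $ e s) = 0"
      by (simp only: k(1)) simp
    then have "(\<Sum>i\<in>UNIV. real_of_int (k i) * real_of_int (g i $ e s)) = 0"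
      by simp
    then show ?thesis
      by (simp add: g[OF that] a_def inner_vec_def)
  qed
  then have sub: "span S \<subseteq> {x. a \<bullet> x = 0}"
    by (intro span_minimal subspace_hyperplane) auto
  have spanS: "span S = span (real_vec ` N)"
    using S by (metis span_eq span_superset subset_trans)
  have span_eq: "span (real_vec ` N) = {x. a \<bullet> x = 0}"
  proof (rule subspace_dim_equal)
    show "dim {x. a \<bullet> x = 0} \<le> dim (span (real_vec ` N))"
      using assms(2) \<open>a \<noteq> 0\<close> by (simp add: dim_hyperplane)
  qed (use sub spanS in \<open>auto simp: subspace_hyperplane\<close>)
  have phi_N: "phi v = 0" if "v \<in> N" for v
  proof -
    have "real_vec v \<in> span (real_vec ` N)"
      using that by (auto intro: span_base)
    then have "real_of_int (phi v) = 0"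
      unfolding phi_inner span_eq by simp
    then show ?thesis by simp
  qed
  have phi_M: "v = 0" if "v \<in> M" "phi v = 0" for v
  proof -
    have "real_of_int (phi v) = 0"
      using that(2) by simp
    then have "real_vec v \<in> span (real_vec ` N)"
      unfolding phi_inner span_eq by simp
    then show "v = 0"
      using direct_summand_saturated[OF assms(1)] that(1) M(2) by blast
  qed
  have "\<exists>v\<in>M. phi v > 0"
  proof -
    have "phi (axis i0 1) \<noteq> 0"
      using k(2) by (simp add: phi_def axis_def if_distrib cong: if_cong)
    obtain v w where vw: "v \<in> N" "w \<in> M" "axis i0 1 = v + w"
      using NM by blast
    have "phi w \<noteq> 0"
      using \<open>phi (axis i0 1) \<noteq> 0\<close> phi_N[OF vw(1)] unfolding vw(3) phi_add by simp
    moreover have "phi (- w) = - phi w"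
      using phi_smult[of "-1" w] by simp
    ultimately show ?thesis
      using vw(2) int_vec.subspace_neg[OF M(1) vw(2)] by (metis neg_0_less_iff_less linorder_neqE_linordered_idom)
  qed
  \<comment> \<open>The values of \<open>phi\<close> on \<open>M\<close> form a subgroup of the integers; it is generated by its
    least positive element.\<close>
  then obtain b where b: "b \<in> M" "phi b > 0" and least: "\<And>v. v \<in> M \<Longrightarrow> phi v > 0 \<Longrightarrow> nat (phi b) \<le> nat (phi v)"
    using ex_has_least_nat[of "\<lambda>v. v \<in> M \<and> phi v > 0" _ "\<lambda>v. nat (phi v)"] by blast
  show thesis
  proof (rule that[of b])
    show "real_vec b \<notin> span (real_vec ` N)"
      using direct_summand_saturated[OF assms(1), of b] phi_N[of b] b(2) by auto
    fix w
    obtain v m where vm: "v \<in> N" "m \<in> M" "w = v + m"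
      using NM by blast
    define q where "q = phi m div phi b"
    define r where "r = m + (- q) *s b"
    have "r \<in> M"
      unfolding r_def by (intro int_vec.subspace_add int_vec.subspace_scale M vm b)
    have "phi r = phi m mod phi b"
      by (simp only: r_def phi_add phi_smult q_def) (simp add: minus_div_mult_eq_mod [symmetric])
    then have "phi r < phi b" "phi r \<ge> 0"
      using b(2) by simp_all
    then have "phi r = 0"
      using least[OF \<open>r \<in> M\<close>] by linarith
    then have "r = 0"
      using phi_M \<open>r \<in> M\<close> by blast
    then have "w = v + q *s b"
      by (simp add: vm(3) r_def)
    then show "\<exists>a\<in>N. \<exists>k. w = a + k *s b"
      using vm(1) by blast
  qed
qed

lemma int_span_family:
  assumes "finite I" "v \<in> int_vec.span (xi ` I)"
  obtains m where "v = (\<Sum>i\<in>I. m i *s xi i)"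
proof -
  have "\<exists>m. v = (\<Sum>i\<in>I. m i *s xi i)"
    using assms(2)
  proof (induction rule: int_vec.span_induct_alt)
    case base
    show ?case by (auto intro: exI[of _ "\<lambda>_. 0"])
  next
    case (step c x y)
    then obtain m i where m: "y = (\<Sum>i\<in>I. m i *s xi i)" and i: "i \<in> I" "x = xi i" by blast
    have "(\<Sum>l\<in>I. (m l + (if l = i then c else 0)) *s xi l)
        = (\<Sum>l\<in>I. m l *s xi l) + (\<Sum>l\<in>I. if l = i then c *s xi l else 0)"
      unfolding sum.distrib[symmetric] by (intro sum.cong) (auto simp: int_vec.scale_left_distrib)
    also have "\<dots> = y + c *s x"
      using assms(1) i m by simp
    finally show ?case
      by (metis add.commute)
  qed
  then show ?thesis using that by blast
qed

lemma vertex_in_simplex_face: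
  assumes "j \<notin> I"
  shows "vertex j \<in> simplex_face I"
  using assms by (auto simp: simplex_face_def std_simplex_def facet_def intro!: hull_inc)

text \<open>Omitting any single facet leaves facets that meet in a vertex. So a relation between all the
  \<open>xi i\<close> with one vanishing coefficient is trivial.\<close>

lemma proper_subfamily_independent:
  fixes xi :: "'n::finite \<Rightarrow> int^'n"
  assumes "hyper_characteristic xi" "(\<Sum>i\<in>UNIV. c i *\<^sub>R real_vec (xi i)) = 0" "c j = 0"
  shows "c i = 0"
proof (cases "i = j")
  case False
  have "has_rank (int_vec.span (xi ` (- {j}))) (card (- {j}))"
    using assms(1) vertex_in_simplex_face[of j "- {j}"] unfolding hyper_characteristic_def by blast
  moreover have "(\<Sum>i\<in>- {j}. c i *\<^sub>R real_vec (xi i)) = 0"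
    using assms(2,3) by (subst (asm) sum.remove[of UNIV j]) (auto simp: Compl_eq_Diff_UNIV)
  ultimately show ?thesis
    using False by (intro relation_trivial_if_full_rank[of "- {j}" xi c]) auto
qed (use assms in simp)

lemma hyper_characteristic_facet_complement:
  fixes xi :: "'n::finite \<Rightarrow> int^'n"
  assumes "hyper_characteristic xi"
  obtains b where "real_vec b \<notin> span (real_vec ` xi ` (- {j}))"
    "\<And>w. \<exists>m k. w = (\<Sum>i\<in>- {j}. m i *s xi i) + k *s b"
proof -
  let ?N = "int_vec.span (xi ` (- {j}))"
  have N: "direct_summand ?N" "has_rank ?N (card (- {j}))"
    using assms vertex_in_simplex_face[of j "- {j}"] unfolding hyper_characteristic_def by blast+
  have "dim (real_vec ` ?N) + 1 = CARD('n)"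
    using has_rank_imp_dim[OF N(2)] by (simp add: Compl_eq_Diff_UNIV card_Diff_singleton)
  then obtain b where b: "real_vec b \<notin> span (real_vec ` ?N)" "\<And>w. \<exists>a \<in> ?N. \<exists>k. w = a + k *s b"
    using direct_summand_complement_cyclic[OF N(1)] by blast
  show thesis
  proof (rule that[of b])
    show "real_vec b \<notin> span (real_vec ` xi ` (- {j}))"
      using b(1) by (simp add: span_real_vec_int_span)
    show "\<exists>m k. w = (\<Sum>i\<in>- {j}. m i *s xi i) + k *s b" for w
      using b(2)[of w] int_span_family[of "- {j}" _ xi] by (metis finite)
  qed
qed


section \<open>The relation in the case of rank \<open>n\<close>\<close>

text \<open>All the coefficients of a relation are nonzero. Each \<open>xi l\<close> then lies in the real span of the
  other vectors, hence, by saturation, in their integer span; so every quotient of two coefficients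
  is an integer, and so is its inverse.\<close>

lemma relation_signs:
  fixes xi :: "'n::finite \<Rightarrow> int^'n"
  assumes xi: "hyper_characteristic xi" and rank: "has_rank (int_vec.span (range xi)) n" "n < CARD('n)"
  obtains e :: "'n \<Rightarrow> real" where "\<And>i. e i = 1 \<or> e i = - 1"
    "\<And>d. (\<Sum>i\<in>UNIV. d i *\<^sub>R real_vec (xi i)) = 0 \<longleftrightarrow> (\<exists>s. \<forall>i. d i = s * e i)"
proof -
  have "\<exists>c j. (\<Sum>i\<in>UNIV. c i *\<^sub>R real_vec (xi i)) = 0 \<and> c j \<noteq> 0"
  proof (rule ccontr)
    assume "\<not> ?thesis"
    then have contr: "(\<Sum>i\<in>UNIV. c i *\<^sub>R real_vec (xi i)) = 0 \<Longrightarrow> c j = 0" for c j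
      by blast
    let ?f = "\<lambda>i. real_vec (xi i)"
    have inj: "inj ?f"
    proof (rule injI, rule ccontr)
      fix i j assume ij: "?f i = ?f j" "i \<noteq> j"
      have "(\<Sum>l\<in>UNIV. (if l = i then 1 else if l = j then -1 else 0) *\<^sub>R ?f l)
         = (\<Sum>l\<in>UNIV. if l = i then ?f l else 0) + (\<Sum>l\<in>UNIV. if l = j then - ?f l else 0)"
        unfolding sum.distrib[symmetric] using ij(2) by (intro sum.cong) auto
      also have "\<dots> = 0" using ij by simp
      finally show False using contr[of "\<lambda>l. if l = i then 1 else if l = j then -1 else 0" i] by simp
    qed
    have "independent (range ?f)"
    proof (rule ccontr)
      assume "\<not> independent (range ?f)"
      then obtain u v where "v \<in> range ?f" "u v \<noteq> 0" "(\<Sum>v\<in>range ?f. u v *\<^sub>R v) = 0"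
        by (auto simp: dependent_finite)
      then show False
        using contr[of "\<lambda>i. u (?f i)"] by (auto simp: sum.reindex[OF inj])
    qed
    then have "dim (range ?f) = CARD('n)"
      by (simp add: dim_eq_card_independent card_image[OF inj])
    moreover have "dim (range ?f) = n"
      using has_rank_imp_dim[OF rank(1)] by (metis dim_span image_image span_real_vec_int_span)
    ultimately show False using rank(2) by simp
  qed
  then obtain c j where c: "(\<Sum>i\<in>UNIV. c i *\<^sub>R real_vec (xi i)) = 0" "c j \<noteq> 0" by blast
  have nz: "c i \<noteq> 0" for i
    using proper_subfamily_independent[OF xi c(1)] c(2) by blast
  have ratio: "c i / c l \<in> \<int>" for i l
  proof (cases "i = l")
    case False
    let ?N = "int_vec.span (xi ` (- {l}))"
    have N: "direct_summand ?N"
      using xi vertex_in_simplex_face[of l "- {l}"] unfolding hyper_characteristic_def by blast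
    have "c l *\<^sub>R real_vec (xi l) = - (\<Sum>i\<in>- {l}. c i *\<^sub>R real_vec (xi i))"
      using c(1) by (simp add: sum.remove[of UNIV l] Compl_eq_Diff_UNIV eq_neg_iff_add_eq_0)
    then have "real_vec (xi l) = (1 / c l) *\<^sub>R - (\<Sum>i\<in>- {l}. c i *\<^sub>R real_vec (xi i))"
      using nz[of l] by (metis scaleR_scaleR nonzero_divide_eq_eq scaleR_one)
    also have "\<dots> \<in> span (real_vec ` ?N)"
      by (intro span_scale span_neg span_sum span_base imageI int_vec.span_base) auto
    finally have "xi l \<in> ?N"
      using direct_summand_saturated[OF N] by blast
    then obtain m where m: "xi l = (\<Sum>i\<in>- {l}. m i *s xi i)"
      using int_span_family[of "- {l}"] by (metis finite)
    \<comment> \<open>Eliminating \<open>xi l\<close> from the relation leaves a trivial relation.\<close>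
    define d where "d i = (if i = l then 0 else c i + c l * of_int (m i))" for i
    have "(\<Sum>i\<in>UNIV. d i *\<^sub>R real_vec (xi i)) = (\<Sum>i\<in>- {l}. d i *\<^sub>R real_vec (xi i))"
      by (intro sum.mono_neutral_right) (auto simp: d_def)
    also have "\<dots> = (\<Sum>i\<in>- {l}. c i *\<^sub>R real_vec (xi i) + c l *\<^sub>R real_vec (m i *s xi i))"
      by (intro sum.cong) (auto simp: d_def real_vec_smult algebra_simps)
    also have "\<dots> = (\<Sum>i\<in>- {l}. c i *\<^sub>R real_vec (xi i)) + c l *\<^sub>R real_vec (xi l)"
      by (simp only: sum.distrib scaleR_right.sum[symmetric] real_vec_sum[symmetric] m[symmetric])
    also have "\<dots> = (\<Sum>i\<in>UNIV. c i *\<^sub>R real_vec (xi i))"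
      by (simp add: sum.remove[of UNIV l] Compl_eq_Diff_UNIV)
    finally have "d i = 0"
      using c(1) proper_subfamily_independent[OF xi, of d l] by (simp add: d_def)
    then have "c i / c l = of_int (- m i)"
      using False nz[of l] by (simp add: d_def field_simps)
    then show ?thesis by (metis Ints_of_int)
  qed (use nz in simp)
  define e where "e i = c i / c j" for i
  have e: "e i = 1 \<or> e i = - 1" for i
  proof -
    obtain p q :: int where "c i / c j = of_int p" "c j / c i = of_int q"
      using ratio by (metis Ints_cases)
    moreover from this have "of_int (p * q) = (1::real)"
      using nz by (simp flip: \<open>c i / c j = _\<close> \<open>c j / c i = _\<close>)
    then have "p * q = 1" by linarith
    then have "p = 1 \<or> p = -1"
      by (metis zmult_eq_1_iff)
    ultimately show ?thesis by (auto simp: e_def)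
  qed
  show thesis
  proof (rule that[of e, OF e])
    fix d
    have rel_e: "(\<Sum>i\<in>UNIV. (s * e i) *\<^sub>R real_vec (xi i)) = 0" for s
    proof -
      have "(\<Sum>i\<in>UNIV. (s * e i) *\<^sub>R real_vec (xi i)) = (s / c j) *\<^sub>R (\<Sum>i\<in>UNIV. c i *\<^sub>R real_vec (xi i))"
        by (simp add: scaleR_right.sum e_def)
      then show ?thesis by (simp add: c(1))
    qed
    show "(\<Sum>i\<in>UNIV. d i *\<^sub>R real_vec (xi i)) = 0 \<longleftrightarrow> (\<exists>s. \<forall>i. d i = s * e i)"
    proof
      assume d: "(\<Sum>i\<in>UNIV. d i *\<^sub>R real_vec (xi i)) = 0"
      have rel0: "(\<Sum>i\<in>UNIV. (d i - d j * e i) *\<^sub>R real_vec (xi i)) = 0"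
        using d rel_e[of "d j"] by (simp add: scaleR_left_diff_distrib sum_subtractf)
      have "d i - d j * e i = 0" for i
        by (rule proper_subfamily_independent[OF xi rel0, of j]) (use nz[of j] in \<open>simp add: e_def\<close>)
      then have "d i = d j * e i" for i
        by (rule eq_iff_diff_eq_0[THEN iffD2])
      then show "\<exists>s. \<forall>i. d i = s * e i" by blast
    next
      assume "\<exists>s. \<forall>i. d i = s * e i"
      then show "(\<Sum>i\<in>UNIV. d i *\<^sub>R real_vec (xi i)) = 0"
        using rel_e by auto
    qed
  qed
qed


section \<open>Linear parametrisations of the torus\<close>

lemma linear_lincomb:
  fixes b :: "'n::finite \<Rightarrow> 'b::real_vector"
  shows "linear (\<lambda>x::real^'n::finite. \<Sum>i\<in>UNIV. (x $ i) *\<^sub>R b i)"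
  by (rule linearI) (simp_all add: scaleR_left_distrib sum.distrib scaleR_right.sum)

definition lin_indep :: "('n::finite \<Rightarrow> int^'n) \<Rightarrow> bool" where
  "lin_indep b \<longleftrightarrow> (\<forall>c. (\<Sum>i\<in>UNIV. c i *\<^sub>R real_vec (b i)) = 0 \<longrightarrow> (\<forall>i. c i = 0))"

definition lattice_basis :: "('n::finite \<Rightarrow> int^'n) \<Rightarrow> bool" where
  "lattice_basis b \<longleftrightarrow> lin_indep b \<and> (\<forall>w. \<exists>m. w = (\<Sum>i\<in>UNIV. m i *s b i))"

lemma lin_indepD: "lin_indep b \<Longrightarrow> (\<Sum>i\<in>UNIV. c i *\<^sub>R real_vec (b i)) = 0 \<Longrightarrow> c i = 0"
  by (simp add: lin_indep_def)

lemma lincomb_lattice_iff: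
  fixes b :: "'n::finite \<Rightarrow> int^'n"
  assumes "lattice_basis b"
  shows "(\<Sum>i\<in>UNIV. (x $ i) *\<^sub>R real_vec (b i)) \<in> range real_vec \<longleftrightarrow> (\<forall>i. x $ i \<in> \<int>)"
proof
  assume "(\<Sum>i\<in>UNIV. (x $ i) *\<^sub>R real_vec (b i)) \<in> range real_vec"
  then obtain w where "(\<Sum>i\<in>UNIV. (x $ i) *\<^sub>R real_vec (b i)) = real_vec w" by blast
  moreover obtain m where "w = (\<Sum>i\<in>UNIV. m i *s b i)" using assms by (auto simp: lattice_basis_def)
  ultimately have "(\<Sum>i\<in>UNIV. (x $ i - of_int (m i)) *\<^sub>R real_vec (b i)) = 0"
    by (simp add: scaleR_left_diff_distrib sum_subtractf real_vec_sum real_vec_smult)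
  then have "x $ i = of_int (m i)" for i
    using lin_indepD[of b "\<lambda>i. x $ i - of_int (m i)"] assms by (simp add: lattice_basis_def)
  then show "\<forall>i. x $ i \<in> \<int>" by simp
next
  assume "\<forall>i. x $ i \<in> \<int>"
  then have "\<forall>i. \<exists>m. x $ i = of_int m" by (metis Ints_cases)
  then obtain m where "\<And>i. x $ i = of_int (m i)" by metis
  then have "(\<Sum>i\<in>UNIV. (x $ i) *\<^sub>R real_vec (b i)) = real_vec (\<Sum>i\<in>UNIV. m i *s b i)"
    by (simp add: real_vec_sum real_vec_smult)
  then show "(\<Sum>i\<in>UNIV. (x $ i) *\<^sub>R real_vec (b i)) \<in> range real_vec" by blast
qed

lemma surj_lincomb:
  fixes b :: "'n::finite \<Rightarrow> int^'n"
  assumes "lin_indep b"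
  shows "surj (\<lambda>x::real^'n. \<Sum>i\<in>UNIV. (x $ i) *\<^sub>R real_vec (b i))"
proof (rule linear_injective_imp_surjective[OF linear_lincomb])
  show "inj (\<lambda>x::real^'n. \<Sum>i\<in>UNIV. (x $ i) *\<^sub>R real_vec (b i))"
    unfolding linear_injective_0[OF linear_lincomb]
    using lin_indepD[OF assms] by (auto simp: vec_eq_iff)
qed simp

lemma hyper_characteristic_adapted_basis:
  fixes xi :: "'n::finite \<Rightarrow> int^'n"
  assumes xi: "hyper_characteristic xi"
  obtains b where "\<And>i. i \<noteq> j \<Longrightarrow> b i = xi i"
    "lattice_basis b"
proof -
  obtain v where v: "real_vec v \<notin> span (real_vec ` xi ` (- {j}))"
    "\<And>w. \<exists>m k. w = (\<Sum>i\<in>- {j}. m i *s xi i) + k *s v"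
    using hyper_characteristic_facet_complement[OF xi] by blast
  define b where "b = xi(j := v)"
  have split: "(\<Sum>i\<in>UNIV. f i (b i)) = f j v + (\<Sum>i\<in>-{j}. f i (xi i))"
    for f :: "'n \<Rightarrow> int^'n \<Rightarrow> 'b::ab_group_add"
    by (auto simp: sum.remove[of UNIV j] b_def Compl_eq_Diff_UNIV intro!: sum.cong)
  have indep: "\<forall>i. c i = 0" if 0: "(\<Sum>i\<in>UNIV. c i *\<^sub>R real_vec (b i)) = 0" for c
  proof -
    have eq: "c j *\<^sub>R real_vec v = - (\<Sum>i\<in>-{j}. c i *\<^sub>R real_vec (xi i))"
      using 0 split[of "\<lambda>i x. c i *\<^sub>R real_vec x"] by (simp add: eq_neg_iff_add_eq_0)
    have span: "- (\<Sum>i\<in>-{j}. c i *\<^sub>R real_vec (xi i)) \<in> span (real_vec ` xi ` (- {j}))"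
      by (intro span_neg span_sum span_scale span_base) auto
    have cj: "c j = 0"
    proof (rule ccontr)
      assume "c j \<noteq> 0"
      then have "real_vec v = (1 / c j) *\<^sub>R (c j *\<^sub>R real_vec v)" by simp
      also have "\<dots> \<in> span (real_vec ` xi ` (- {j}))"
        unfolding eq using span by (rule span_scale)
      finally show False using v(1) by blast
    qed
    have "(\<Sum>i\<in>UNIV. c i *\<^sub>R real_vec (xi i)) = c j *\<^sub>R real_vec (xi j) + (\<Sum>i\<in>-{j}. c i *\<^sub>R real_vec (xi i))"
      by (simp add: sum.remove[of UNIV j] Compl_eq_Diff_UNIV)
    also have "\<dots> = 0"
      using eq cj by simp
    finally show "\<forall>i. c i = 0"
      using proper_subfamily_independent[OF xi, of c j] cj by blast
  qed
  have gen: "\<exists>m. w = (\<Sum>i\<in>UNIV. m i *s b i)" for w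
  proof -
    obtain m k where mk: "w = (\<Sum>i\<in>- {j}. m i *s xi i) + k *s v"
      using v(2) by blast
    have "(\<Sum>i\<in>- {j}. (m(j := k)) i *s xi i) = (\<Sum>i\<in>- {j}. m i *s xi i)"
      by (intro sum.cong) auto
    then have "w = (\<Sum>i\<in>UNIV. (m(j := k)) i *s b i)"
      using split[of "\<lambda>i x. (m(j := k)) i *s x"] mk by simp
    then show ?thesis by blast
  qed
  have "lattice_basis b"
    using indep gen by (simp add: lattice_basis_def lin_indep_def)
  then show thesis
    by (rule that[rotated]) (simp add: b_def)
qed

lemma full_rank_independent:
  fixes xi :: "'n::finite \<Rightarrow> int^'n"
  assumes "has_rank (int_vec.span (range xi)) CARD('n)"
  shows "lin_indep xi"
  using relation_trivial_if_full_rank[of UNIV xi] assms by (auto simp: lin_indep_def)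

text \<open>In rank \<open>n\<close>, the parametrisation has one superfluous real parameter, which runs along the
  relation between the \<open>xi i\<close>. Keeping it treats all facets alike and makes the relation visible as
  the diagonal.\<close>

lemma corank_one_parametrisation:
  fixes xi :: "'n::finite \<Rightarrow> int^'n"
  assumes xi: "hyper_characteristic xi" and rank: "has_rank (int_vec.span (range xi)) n" "CARD('n) = n + 1"
  obtains e :: "'n \<Rightarrow> real" and v where "\<And>i. e i = 1 \<or> e i = - 1"
    "surj (\<lambda>(t::real, x::real^'n). t *\<^sub>R real_vec v + (\<Sum>i\<in>UNIV. (x $ i) *\<^sub>R (e i *\<^sub>R real_vec (xi i))))"
    "\<And>t x. t *\<^sub>R real_vec v + (\<Sum>i\<in>UNIV. (x $ i) *\<^sub>R (e i *\<^sub>R real_vec (xi i))) \<in> range real_vec \<longleftrightarrow>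
       t \<in> \<int> \<and> (\<exists>s. \<forall>i. x $ i - s \<in> \<int>)"
proof -
  obtain e :: "'n \<Rightarrow> real" where e: "\<And>i. e i = 1 \<or> e i = - 1"
    and rel: "\<And>d. (\<Sum>i\<in>UNIV. d i *\<^sub>R real_vec (xi i)) = 0 \<longleftrightarrow> (\<exists>s. \<forall>i. d i = s * e i)"
    using relation_signs[OF xi rank(1)] rank(2) by auto
  \<comment> \<open>Any index will do.\<close>
  define j :: 'n where "j = undefined"
  obtain b where b: "\<And>i. i \<noteq> j \<Longrightarrow> b i = xi i"
    "lattice_basis b"
    using hyper_characteristic_adapted_basis[OF xi] by blast
  define v where "v = b j"
  have e2: "e i * e i = 1" for i
    using e[of i] by auto
  define F where "F = (\<lambda>(t::real, x::real^'n). t *\<^sub>R real_vec v + (\<Sum>i\<in>UNIV. (x $ i) *\<^sub>R (e i *\<^sub>R real_vec (xi i))))"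
  have shift: "F (t, x + (\<chi> i. s)) = F (t, x)" for t x s
  proof -
    have "(\<Sum>i\<in>UNIV. (s * e i) *\<^sub>R real_vec (xi i)) = 0"
      unfolding rel by blast
    then show ?thesis
      by (simp add: F_def algebra_simps sum.distrib)
  qed
  \<comment> \<open>Along the relation, the coordinate at \<open>j\<close> can be moved to zero; there the parametrisation
    is the one given by the basis \<open>b\<close>.\<close>
  define c where "c t x = (\<chi> i. if i = j then t else (x $ i - x $ j) * e i)" for t and x :: "real^'n"
  have F_c: "F (t, x) = (\<Sum>i\<in>UNIV. (c t x $ i) *\<^sub>R real_vec (b i))" for t x
  proof -
    have "F (t, x) = F (t, x + (\<chi> i. - x $ j))"
      by (rule shift[symmetric])
    also have "\<dots> = t *\<^sub>R real_vec v + (\<Sum>i\<in>UNIV. (x $ i - x $ j) *\<^sub>R (e i *\<^sub>R real_vec (xi i)))"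
      by (simp add: F_def)
    also have "\<dots> = (\<Sum>i\<in>UNIV. (c t x $ i) *\<^sub>R real_vec (b i))"
      by (auto simp: sum.remove[of UNIV j] c_def v_def b(1) intro!: sum.cong)
    finally show ?thesis .
  qed
  show thesis
  proof (rule that[of e v, OF e])
    have "y \<in> range F" for y
    proof -
      obtain z :: "real^'n" where z: "y = (\<Sum>i\<in>UNIV. (z $ i) *\<^sub>R real_vec (b i))"
        using surj_lincomb[of b] b(2) by (meson surjD lattice_basis_def)
      define x :: "real^'n" where "x = (\<chi> i. if i = j then 0 else z $ i * e i)"
      have "c (z $ j) x = z"
        by (auto simp: c_def x_def vec_eq_iff mult.assoc e2)
      then have "y = F (z $ j, x)"
        by (simp add: F_c z)
      then show ?thesis by blast
    qed
    then show "surj (\<lambda>(t::real, x::real^'n). t *\<^sub>R real_vec v + (\<Sum>i\<in>UNIV. (x $ i) *\<^sub>R (e i *\<^sub>R real_vec (xi i))))"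
      unfolding F_def by blast
    fix t and x :: "real^'n"
    have "t *\<^sub>R real_vec v + (\<Sum>i\<in>UNIV. (x $ i) *\<^sub>R (e i *\<^sub>R real_vec (xi i))) = F (t, x)"
      by (simp add: F_def)
    moreover have "F (t, x) \<in> range real_vec \<longleftrightarrow> (\<forall>i. c t x $ i \<in> \<int>)"
      unfolding F_c by (rule lincomb_lattice_iff[OF b(2)])
    moreover have "(\<forall>i. c t x $ i \<in> \<int>) \<longleftrightarrow> t \<in> \<int> \<and> (\<exists>s. \<forall>i. x $ i - s \<in> \<int>)"
    proof -
      have sgn: "y * e i \<in> \<int> \<longleftrightarrow> y \<in> \<int>" for y i
        using e[of i] by auto
      have c_int: "c t x $ i \<in> \<int> \<longleftrightarrow> (if i = j then t \<in> \<int> else x $ i - x $ j \<in> \<int>)" for i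
        using sgn[of "x $ i - x $ j" i] by (simp add: c_def)
      have "x $ j - x $ j \<in> \<int>" by simp
      then have "(\<forall>i. c t x $ i \<in> \<int>) \<longleftrightarrow> t \<in> \<int> \<and> (\<forall>i. x $ i - x $ j \<in> \<int>)"
        unfolding c_int by metis
      moreover have "x $ i - x $ j \<in> \<int>" if "\<forall>i. x $ i - s \<in> \<int>" for s i
        using Ints_diff[of "x $ i - s" "x $ j - s"] that by simp
      ultimately show ?thesis by blast
    qed
    ultimately show "t *\<^sub>R real_vec v + (\<Sum>i\<in>UNIV. (x $ i) *\<^sub>R (e i *\<^sub>R real_vec (xi i))) \<in> range real_vec \<longleftrightarrow>
       t \<in> \<int> \<and> (\<exists>s. \<forall>i. x $ i - s \<in> \<int>)"
      by simp
  qed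
qed


section \<open>Faces of the simplex\<close>

lemma vertex_nth: "vertex j $ i = (if i = j then 1 else 0)"
  by (simp add: vertex_def axis_def)

lemma inj_vertex: "inj (vertex :: 'n::finite \<Rightarrow> real^'n)"
  by (auto simp: inj_def vec_eq_iff vertex_nth)

lemma affine_independent_vertices: "\<not> affine_dependent (vertex ` S :: (real^'n::finite) set)"
proof -
  have "independent (vertex ` S)"
    by (rule independent_mono[OF independent_Basis]) (auto simp: vertex_def axis_in_Basis_iff)
  then show ?thesis
    using affine_dependent_imp_dependent by blast
qed

lemma sum_vertices_nth:
  "(\<Sum>v\<in>vertex ` S. u v *\<^sub>R v) $ i = (if i \<in> S then u (vertex i) else 0)"
proof -
  have "(\<Sum>v\<in>vertex ` S. u v *\<^sub>R v) $ i = (\<Sum>j\<in>S. if j = i then u (vertex i) else 0)"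
    unfolding sum.reindex[OF inj_on_subset[OF inj_vertex subset_UNIV]] sum_component
    by (intro sum.cong) (auto simp: vertex_nth)
  then show ?thesis by simp
qed

text \<open>Stated for an arbitrary condition \<open>P\<close> on the coefficients in order to cover convex hulls
  (\<open>\<ge> 0\<close>) and their relative interiors (\<open>> 0\<close>) at once.\<close>

lemma barycentric_representation:
  fixes x :: "real^'n::finite"
  shows "(\<exists>u. (\<forall>v\<in>vertex ` S. P (u v)) \<and> sum u (vertex ` S) = 1 \<and> (\<Sum>v\<in>vertex ` S. u v *\<^sub>R v) = x) \<longleftrightarrow>
    (\<forall>i\<in>S. P (x $ i)) \<and> (\<forall>i. i \<notin> S \<longrightarrow> x $ i = 0) \<and> (\<Sum>i\<in>UNIV. x $ i) = 1"
    (is "?L \<longleftrightarrow> ?R")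
proof -
  have sum_eq: "(\<Sum>i\<in>UNIV. x $ i) = (\<Sum>i\<in>S. x $ i)" if "\<forall>i. i \<notin> S \<longrightarrow> x $ i = 0"
    using that by (intro sum.mono_neutral_right) auto
  show ?thesis
  proof
    assume ?L
    then obtain u where u: "\<forall>v\<in>vertex ` S. P (u v)" "sum u (vertex ` S) = 1" "(\<Sum>v\<in>vertex ` S. u v *\<^sub>R v) = x"
      by blast
    have x: "x $ i = (if i \<in> S then u (vertex i) else 0)" for i
      unfolding u(3)[symmetric] by (rule sum_vertices_nth)
    have "(\<Sum>i\<in>S. x $ i) = 1"
      using u(2) by (simp add: x sum.reindex inj_on_subset[OF inj_vertex])
    then show ?R using u(1) sum_eq by (auto simp: x)
  next
    assume R: ?R
    define u where "u v = x $ (the_inv vertex v)" for v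
    have u: "u (vertex i) = x $ i" for i
      by (simp add: u_def the_inv_f_f[OF inj_vertex])
    have "(\<Sum>v\<in>vertex ` S. u v *\<^sub>R v) = x"
      using R unfolding vec_eq_iff sum_vertices_nth by (simp add: u)
    moreover have "sum u (vertex ` S) = 1"
      using R sum_eq by (simp add: sum.reindex inj_on_subset[OF inj_vertex] u)
    ultimately show ?L using R u by (intro exI[of _ u]) auto
  qed
qed

lemma convex_hull_vertices:
  "convex hull (vertex ` S) = {x :: real^'n::finite. (\<forall>i. 0 \<le> x $ i) \<and> (\<forall>i. i \<notin> S \<longrightarrow> x $ i = 0) \<and> (\<Sum>i\<in>UNIV. x $ i) = 1}"
proof -
  have "x \<in> convex hull (vertex ` S) \<longleftrightarrow> (\<forall>i\<in>S. 0 \<le> x $ i) \<and> (\<forall>i. i \<notin> S \<longrightarrow> x $ i = 0) \<and> (\<Sum>i\<in>UNIV. x $ i) = 1" for x :: "real^'n"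
    by (simp only: convex_hull_finite[OF finite_imageI[OF finite[of S]]] mem_Collect_eq
        barycentric_representation[of S "\<lambda>a. 0 \<le> a", symmetric])
  then show ?thesis by (force intro: order.refl)
qed

lemma mem_std_simplex: "x \<in> std_simplex \<longleftrightarrow> (\<forall>i. 0 \<le> x $ i) \<and> (\<Sum>i\<in>UNIV. x $ i) = 1"
  by (simp add: std_simplex_def convex_hull_vertices)

lemma simplex_face_convex_hull: "simplex_face I = convex hull (vertex ` (- I))"
  by (auto simp: simplex_face_def facet_def std_simplex_def convex_hull_vertices)

text \<open>The faces are parametrised by the vanishing sets of barycentric coordinates, which makes the
  relation defining \<open>L\<close> computable.\<close>

lemma rel_interior_simplex_face:
  "x \<in> rel_interior (simplex_face I) \<longleftrightarrow> x \<in> std_simplex \<and> I = {i. x $ i = 0}"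
proof -
  have "x \<in> rel_interior (simplex_face I) \<longleftrightarrow>
      (\<forall>i\<in>-I. 0 < x $ i) \<and> (\<forall>i. i \<notin> -I \<longrightarrow> x $ i = 0) \<and> (\<Sum>i\<in>UNIV. x $ i) = 1"
    by (simp only: simplex_face_convex_hull rel_interior_convex_hull_explicit[OF affine_independent_vertices]
        mem_Collect_eq barycentric_representation[of "-I" "\<lambda>a. 0 < a", symmetric])
  also have "\<dots> \<longleftrightarrow> x \<in> std_simplex \<and> I = {i. x $ i = 0}"
    by (auto simp: mem_std_simplex less_le)
  finally show ?thesis .
qed

lemma compact_std_simplex: "compact std_simplex"
  unfolding std_simplex_def by (intro finite_imp_compact_convex_hull finite_imageI finite)

lemma std_simplex_pos_coordinate:
  assumes "x \<in> std_simplex"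
  obtains j where "x $ j > 0"
proof -
  have "\<exists>j. x $ j \<noteq> 0"
    using assms by (metis mem_std_simplex sum.neutral zero_neq_one)
  then show ?thesis
    using that assms by (metis mem_std_simplex less_le)
qed


section \<open>The torus\<close>

lemma additive_group_simps [simp]:
  "carrier additive_group = UNIV" "x \<otimes>\<^bsub>additive_group\<^esub> y = x + y" "\<one>\<^bsub>additive_group\<^esub> = 0"
  by (simp_all add: additive_group_def)

lemma comm_group_additive_group: "comm_group (additive_group :: 'a::ab_group_add monoid)"
proof (rule comm_groupI)
  show "\<exists>y\<in>carrier additive_group. y \<otimes>\<^bsub>additive_group\<^esub> x = \<one>\<^bsub>additive_group\<^esub>" for x :: 'a
    by (auto intro: exI[of _ "- x"])
qed (simp_all add: algebra_simps)

lemma normal_additive_group: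
  fixes H :: "'a::ab_group_add set"
  assumes "0 \<in> H" "\<And>x y. x \<in> H \<Longrightarrow> y \<in> H \<Longrightarrow> x + y \<in> H" "\<And>x. x \<in> H \<Longrightarrow> - x \<in> H"
  shows "H \<lhd> additive_group"
proof -
  interpret comm_group "additive_group :: 'a monoid"
    by (rule comm_group_additive_group)
  have inv: "inv\<^bsub>additive_group\<^esub> x = - x" for x :: 'a
    by (rule inv_equality) auto
  have "subgroup H additive_group"
    by unfold_locales (use assms in \<open>auto simp: inv\<close>)
  then show ?thesis
    by (rule subgroup_imp_normal)
qed

lemma coset_additive_group: "H #>\<^bsub>additive_group\<^esub> x = (\<lambda>h. h + x) ` H"
  by (auto simp: r_coset_def)

lemma normal_lattice: "range real_vec \<lhd> (additive_group :: (real^'n::finite) monoid)"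
proof (rule normal_additive_group)
  show "0 \<in> range real_vec" by (metis rangeI real_vec_0)
qed (auto simp flip: real_vec_add real_vec_uminus)

lemma group_torus_group: "group (torus_group :: (real^'n::finite) set monoid)"
  unfolding torus_group_def by (rule normal.factorgroup_is_group[OF normal_lattice])

lemma carrier_torus_group: "carrier torus_group = range torus_proj"
  by (auto simp: torus_group_def FactGroup_def RCOSETS_def torus_proj_def)

lemma torus_mult: "torus_proj x \<otimes>\<^bsub>torus_group\<^esub> torus_proj y = torus_proj (x + y)"
  using normal.rcos_sum[OF normal_lattice, of x y] by (simp add: torus_group_def FactGroup_def torus_proj_def)

lemma torus_one: "\<one>\<^bsub>torus_group\<^esub> = torus_proj 0"
  by (simp add: torus_group_def FactGroup_def torus_proj_def coset_additive_group)

lemma torus_inv: "inv\<^bsub>torus_group\<^esub> torus_proj x = torus_proj (- x)"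
proof -
  interpret group "torus_group :: (real^'n) set monoid" by (rule group_torus_group)
  show ?thesis
    by (rule inv_equality) (auto simp: torus_mult torus_one carrier_torus_group)
qed

lemma torus_proj_eq_iff: "torus_proj x = torus_proj y \<longleftrightarrow> x - y \<in> range real_vec"
proof
  assume "torus_proj x = torus_proj y"
  moreover have "x \<in> torus_proj x"
    unfolding torus_proj_def coset_additive_group by (auto simp: image_iff intro!: exI[of _ 0])
  ultimately show "x - y \<in> range real_vec"
    unfolding torus_proj_def coset_additive_group by auto
next
  assume "x - y \<in> range real_vec"
  then obtain v where v: "x = real_vec v + y" by (metis diff_add_cancel rangeE)
  have "real_vec w + y = real_vec (w - v) + x" for w
    by (simp add: v real_vec_diff)
  then have "real_vec w + y \<in> (\<lambda>h. h + x) ` range real_vec" for w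
    by blast
  moreover have "real_vec w + x = real_vec (w + v) + y" for w
    by (simp add: v real_vec_add)
  then have "real_vec w + x \<in> (\<lambda>h. h + y) ` range real_vec" for w
    by blast
  ultimately show "torus_proj x = torus_proj y"
    unfolding torus_proj_def coset_additive_group by blast
qed

lemma open_map_torus_proj: "open_map euclidean torus torus_proj"
  unfolding open_map_def
proof (intro allI impI)
  fix U :: "(real^'n) set" assume "openin euclidean U"
  have "{x. torus_proj x \<in> torus_proj ` U} = (\<Union>v. (\<lambda>x. real_vec v + x) ` U)"
  proof (intro equalityI subsetI)
    fix x assume "x \<in> {x. torus_proj x \<in> torus_proj ` U}"
    then obtain y v where "y \<in> U" "x - y = real_vec v"
      by (auto simp: torus_proj_eq_iff)
    then show "x \<in> (\<Union>v. (\<lambda>x. real_vec v + x) ` U)"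
      by (auto simp: image_iff algebra_simps)
  qed (auto simp: image_iff torus_proj_eq_iff intro!: bexI)
  moreover have "open \<dots>"
    using \<open>openin euclidean U\<close> by (auto intro!: open_UN open_translation)
  ultimately show "openin torus (torus_proj ` U)"
    by (auto simp: torus_def openin_quotient_topology)
qed

lemma quotient_map_torus_proj: "quotient_map euclidean torus torus_proj"
  unfolding torus_def by (rule quotient_map_quotient_topology)


section \<open>The classes of \<open>L\<close>\<close>

lemma span_family:
  fixes f :: "'n::finite \<Rightarrow> 'b::real_vector"
  shows "span (f ` I) = {\<Sum>i\<in>UNIV. c i *\<^sub>R f i | c. \<forall>i. i \<notin> I \<longrightarrow> c i = 0}" (is "_ = ?R")
proof
  show "span (f ` I) \<subseteq> ?R"
  proof (rule span_minimal)
    show "f ` I \<subseteq> ?R"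
    proof (rule image_subsetI)
      fix i assume "i \<in> I"
      have "(\<Sum>j\<in>UNIV. (if j = i then 1 else 0) *\<^sub>R f j) = (\<Sum>j\<in>UNIV. if j = i then f j else 0)"
        by (intro sum.cong) auto
      then have "f i = (\<Sum>j\<in>UNIV. (if j = i then 1 else 0) *\<^sub>R f j)" by simp
      moreover have "\<forall>j. j \<notin> I \<longrightarrow> (if j = i then 1 else 0 :: real) = 0"
        using \<open>i \<in> I\<close> by auto
      ultimately show "f i \<in> ?R"
        by (intro CollectI exI[of _ "\<lambda>j. if j = i then 1 else 0"] conjI)
    qed
    show "subspace ?R"
    proof (rule subspaceI)
      show "0 \<in> ?R"
        by (auto intro!: exI[of _ "\<lambda>_. 0"])
    next
      fix x y assume "x \<in> ?R" "y \<in> ?R"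
      then obtain c d where "x = (\<Sum>i\<in>UNIV. c i *\<^sub>R f i)" "y = (\<Sum>i\<in>UNIV. d i *\<^sub>R f i)"
        and "\<forall>i. i \<notin> I \<longrightarrow> c i = 0" "\<forall>i. i \<notin> I \<longrightarrow> d i = 0" by blast
      then show "x + y \<in> ?R"
        by (intro CollectI exI[of _ "\<lambda>i. c i + d i"]) (simp add: scaleR_left_distrib sum.distrib)
    next
      fix a x assume "x \<in> ?R"
      then obtain c where "x = (\<Sum>i\<in>UNIV. c i *\<^sub>R f i)" "\<forall>i. i \<notin> I \<longrightarrow> c i = 0" by blast
      then show "a *\<^sub>R x \<in> ?R"
        by (intro CollectI exI[of _ "\<lambda>i. a * c i"]) (simp add: scaleR_right.sum)
    qed
  qed
  have "(\<Sum>i\<in>UNIV. c i *\<^sub>R f i) \<in> span (f ` I)" if "\<forall>i. i \<notin> I \<longrightarrow> c i = 0" for c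
  proof (rule span_sum)
    fix i show "c i *\<^sub>R f i \<in> span (f ` I)"
      using that by (cases "i \<in> I") (auto intro: span_scale span_base span_zero)
  qed
  then show "?R \<subseteq> span (f ` I)" by blast
qed

text \<open>The preimage in \<open>\<real>\<^sup>n\<^sup>+\<^sup>1\<close> of the torus subgroup \<open>T\<^sub>F\<close>, for the face \<open>F\<close> with \<open>x\<close> in its relative
  interior.\<close>

definition isotropy :: "('n \<Rightarrow> int^'n) \<Rightarrow> real^'n::finite \<Rightarrow> (real^'n) set" where
  "isotropy xi x = {w. \<exists>c. (\<forall>i. x $ i \<noteq> 0 \<longrightarrow> c i = 0) \<and>
     w - (\<Sum>i\<in>UNIV. c i *\<^sub>R real_vec (xi i)) \<in> range real_vec}"

definition L_class :: "('n \<Rightarrow> int^'n) \<Rightarrow> real^'n::finite \<Rightarrow> real^'n \<Rightarrow> ((real^'n) set \<times> (real^'n)) set" where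
  "L_class xi a x = L_rel xi `` {(torus_proj a, x)}"

lemma isotropy_0: "0 \<in> isotropy xi x"
  by (auto simp: isotropy_def image_iff intro!: exI[of _ "\<lambda>_. 0"] exI[of _ "0 :: int^'n"])

lemma isotropy_diff:
  assumes "v \<in> isotropy xi x" "w \<in> isotropy xi x"
  shows "v - w \<in> isotropy xi x"
proof -
  obtain c a where c: "\<forall>i. x $ i \<noteq> 0 \<longrightarrow> c i = 0" "v - (\<Sum>i\<in>UNIV. c i *\<^sub>R real_vec (xi i)) = real_vec a"
    using assms(1) by (auto simp: isotropy_def)
  obtain d b where d: "\<forall>i. x $ i \<noteq> 0 \<longrightarrow> d i = 0" "w - (\<Sum>i\<in>UNIV. d i *\<^sub>R real_vec (xi i)) = real_vec b"
    using assms(2) by (auto simp: isotropy_def)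
  have "(v - w) - (\<Sum>i\<in>UNIV. (c i - d i) *\<^sub>R real_vec (xi i)) = real_vec (a - b)"
    unfolding real_vec_diff c(2)[symmetric] d(2)[symmetric]
    by (simp add: scaleR_left_diff_distrib sum_subtractf)
  then show ?thesis
    using c(1) d(1) unfolding isotropy_def
    by (intro CollectI exI[of _ "\<lambda>i. c i - d i"]) auto
qed

lemma isotropy_uminus: "v \<in> isotropy xi x \<Longrightarrow> - v \<in> isotropy xi x"
  using isotropy_diff[OF isotropy_0] by simp

lemma isotropy_add: "v \<in> isotropy xi x \<Longrightarrow> w \<in> isotropy xi x \<Longrightarrow> v + w \<in> isotropy xi x"
  using isotropy_diff[OF _ isotropy_uminus] by simp

lemma torus_subgroup_iff:
  "torus_proj w \<in> torus_subgroup (int_vec.span (xi ` {i. x $ i = 0})) \<longleftrightarrow> w \<in> isotropy xi x"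
proof -
  have "torus_proj w \<in> torus_subgroup (int_vec.span (xi ` {i. x $ i = 0})) \<longleftrightarrow>
     (\<exists>y\<in>span (real_vec ` xi ` {i. x $ i = 0}). w - y \<in> range real_vec)"
    by (auto simp: torus_subgroup_def span_real_vec_int_span torus_proj_eq_iff[symmetric])
  also have "\<dots> \<longleftrightarrow> w \<in> isotropy xi x"
    unfolding isotropy_def image_image span_family by auto
  finally show ?thesis .
qed

lemma L_rel_iff:
  "((torus_proj a, x), (torus_proj b, y)) \<in> L_rel xi \<longleftrightarrow>
     x \<in> std_simplex \<and> x = y \<and> a - b \<in> isotropy xi x"
  by (auto simp: L_rel_def carrier_torus_group torus_inv torus_mult rel_interior_simplex_face
      torus_subgroup_iff)

lemma L_class_eq:
  "x \<in> std_simplex \<Longrightarrow> L_class xi a x = {(torus_proj b, x) | b. a - b \<in> isotropy xi x}"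
proof (intro equalityI subsetI)
  fix p assume x: "x \<in> std_simplex" and "p \<in> L_class xi a x"
  then have p: "((torus_proj a, x), p) \<in> L_rel xi" by (simp add: L_class_def)
  then obtain b y where "p = (torus_proj b, y)"
    unfolding L_rel_def by (auto simp: carrier_torus_group)
  then show "p \<in> {(torus_proj b, x) | b. a - b \<in> isotropy xi x}"
    using p by (auto simp: L_rel_iff)
qed (auto simp: L_class_def L_rel_iff)

lemma L_class_eq_iff:
  assumes "x \<in> std_simplex" "y \<in> std_simplex"
  shows "L_class xi a x = L_class xi b y \<longleftrightarrow> x = y \<and> a - b \<in> isotropy xi x"
proof
  assume eq: "L_class xi a x = L_class xi b y"
  have "a - a \<in> isotropy xi x" by (simp add: isotropy_0)
  then have "(torus_proj a, x) \<in> L_class xi b y"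
    unfolding eq[symmetric] L_class_eq[OF assms(1)] by blast
  then have "((torus_proj b, y), (torus_proj a, x)) \<in> L_rel xi"
    by (simp add: L_class_def)
  then have "x = y" "b - a \<in> isotropy xi x"
    unfolding L_rel_iff by auto
  with isotropy_uminus[of "b - a" xi x] show "x = y \<and> a - b \<in> isotropy xi x" by simp
next
  assume xy: "x = y \<and> a - b \<in> isotropy xi x"
  have "b - c \<in> isotropy xi x \<longleftrightarrow> a - c \<in> isotropy xi x" for c
  proof
    assume "b - c \<in> isotropy xi x"
    from isotropy_add[OF conjunct2[OF xy] this] show "a - c \<in> isotropy xi x" by simp
  next
    assume "a - c \<in> isotropy xi x"
    from isotropy_diff[OF this conjunct2[OF xy]] show "b - c \<in> isotropy xi x" by simp
  qed
  then show "L_class xi a x = L_class xi b y"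
    using xy assms by (simp add: L_class_eq)
qed

lemma topspace_torus: "topspace torus = range torus_proj"
  by (simp add: torus_def)

lemma topspace_L_space: "topspace (L_space xi) = {L_class xi a x | a x. x \<in> std_simplex}"
  by (auto simp: L_space_def topspace_torus L_class_def)

text \<open>Any linear surjection onto \<open>\<real>\<^sup>n\<^sup>+\<^sup>1\<close> parametrises the torus. The freedom in choosing it is what
  adapts the description of \<open>L\<close> to the vectors \<open>xi i\<close>.\<close>

lemma quotient_map_L_class:
  fixes F :: "'b::euclidean_space \<Rightarrow> real^'n::finite"
  assumes "linear F" "surj F"
  shows "quotient_map (prod_topology euclidean (top_of_set std_simplex)) (L_space xi) (\<lambda>(b, x). L_class xi (F b) x)"
proof -
  have "quotient_map euclidean euclidean F"
    using assms by (intro continuous_open_imp_quotient_map)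
      (auto simp: open_map_def open_surjective_linear_image linear_continuous_on linear_conv_bounded_linear)
  then have "quotient_map euclidean torus (torus_proj \<circ> F)"
    using quotient_map_torus_proj by (rule quotient_map_compose)
  then have "quotient_map (prod_topology euclidean (top_of_set std_simplex)) (prod_topology torus (top_of_set std_simplex))
      (\<lambda>(b, x). ((torus_proj \<circ> F) b, x))"
    by (rule quotient_map_prod_left[rotated 2])
      (auto simp: compact_std_simplex compact_imp_locally_compact_space compact_space_subtopology Hausdorff_space_subtopology)
  moreover have "quotient_map (prod_topology torus (top_of_set std_simplex)) (L_space xi) (\<lambda>p. L_rel xi `` {p})"
    unfolding L_space_def by (rule quotient_map_quotient_topology)
  ultimately have "quotient_map (prod_topology euclidean (top_of_set std_simplex)) (L_space xi)
     ((\<lambda>p. L_rel xi `` {p}) \<circ> (\<lambda>(b, x). ((torus_proj \<circ> F) b, x)))"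
    by (rule quotient_map_compose)
  then show ?thesis
    by (rule quotient_map_eq) (auto simp: L_class_def)
qed


section \<open>The torus action\<close>

lemma torus_action_L_class:
  assumes "x \<in> std_simplex"
  shows "torus_action xi (torus_proj a) (L_class xi b x) = L_class xi (a + b) x"
proof -
  have "L_class xi b x \<in> topspace (L_space xi)"
    using assms by (auto simp: topspace_L_space)
  then have "torus_action xi (torus_proj a) (L_class xi b x)
     = (\<lambda>(s, x). (torus_proj a \<otimes>\<^bsub>torus_group\<^esub> s, x)) ` {(torus_proj c, x) | c. b - c \<in> isotropy xi x}"
    using assms by (simp add: torus_action_def L_class_eq)
  also have "\<dots> = {(torus_proj c, x) | c. (a + b) - c \<in> isotropy xi x}"
  proof (intro equalityI subsetI)
    fix p assume "p \<in> {(torus_proj c, x) | c. (a + b) - c \<in> isotropy xi x}"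
    then obtain c where c: "p = (torus_proj c, x)" "(a + b) - c \<in> isotropy xi x" by blast
    then have "b - (c - a) \<in> isotropy xi x" "p = (torus_proj a \<otimes>\<^bsub>torus_group\<^esub> torus_proj (c - a), x)"
      by (simp_all add: torus_mult algebra_simps)
    then show "p \<in> (\<lambda>(s, x). (torus_proj a \<otimes>\<^bsub>torus_group\<^esub> s, x)) ` {(torus_proj c, x) | c. b - c \<in> isotropy xi x}"
      by force
  next
    fix p assume "p \<in> (\<lambda>(s, x). (torus_proj a \<otimes>\<^bsub>torus_group\<^esub> s, x)) ` {(torus_proj c, x) | c. b - c \<in> isotropy xi x}"
    then obtain c where "p = (torus_proj (a + c), x)" "b - c \<in> isotropy xi x"
      by (auto simp: torus_mult)
    then show "p \<in> {(torus_proj c, x) | c. (a + b) - c \<in> isotropy xi x}"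
      by force
  qed
  finally show ?thesis
    using assms by (simp add: L_class_eq)
qed

lemma torus_action_extensional: "torus_action xi t \<in> extensional (topspace (L_space xi))"
  by (simp add: torus_action_def)

lemma faithful_torus_action:
  "faithful_action torus_group (topspace (L_space xi)) (torus_action (xi :: 'n::finite \<Rightarrow> int^'n))"
proof -
  let ?E = "topspace (L_space xi)"
  have maps: "torus_action xi (torus_proj a) p \<in> ?E" if "p \<in> ?E" for a p
    using that by (force simp: topspace_L_space torus_action_L_class)
  have inverse: "torus_action xi (torus_proj a) (torus_action xi (torus_proj (- a)) p) = p" if "p \<in> ?E" for a p
    using that by (force simp: topspace_L_space torus_action_L_class)
  have bij: "torus_action xi (torus_proj a) \<in> Bij ?E" for a
  proof -
    have "bij_betw (torus_action xi (torus_proj a)) ?E ?E"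
      by (rule bij_betwI[of _ _ _ "torus_action xi (torus_proj (- a))"])
        (use maps inverse[of _ a] inverse[of _ "- a"] in auto)
    then show ?thesis
      by (simp add: Bij_def torus_action_extensional)
  qed
  have mult: "torus_action xi (torus_proj a \<otimes>\<^bsub>torus_group\<^esub> torus_proj b) =
      torus_action xi (torus_proj a) \<otimes>\<^bsub>BijGroup ?E\<^esub> torus_action xi (torus_proj b)" for a b
  proof -
    have "torus_action xi (torus_proj (a + b)) = compose ?E (torus_action xi (torus_proj a)) (torus_action xi (torus_proj b))"
    proof (rule extensionalityI[OF torus_action_extensional compose_extensional])
      fix p assume "p \<in> ?E"
      then show "torus_action xi (torus_proj (a + b)) p = compose ?E (torus_action xi (torus_proj a)) (torus_action xi (torus_proj b)) p"
        by (auto simp: compose_def topspace_L_space torus_action_L_class add.assoc)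
    qed
    then show ?thesis
      using bij by (simp add: BijGroup_def torus_mult)
  qed
  have "group_hom torus_group (BijGroup ?E) (torus_action xi)"
  proof (intro group_hom.intro group_hom_axioms.intro homI)
    show "group (torus_group :: (real^'n) set monoid)" "group (BijGroup ?E)"
      by (rule group_torus_group, rule group_BijGroup)
  next
    fix t :: "(real^'n) set" assume "t \<in> carrier torus_group"
    then show "torus_action xi t \<in> carrier (BijGroup ?E)"
      using bij by (auto simp: carrier_torus_group BijGroup_def)
  next
    fix s t :: "(real^'n) set" assume "s \<in> carrier torus_group" "t \<in> carrier torus_group"
    then show "torus_action xi (s \<otimes>\<^bsub>torus_group\<^esub> t) = torus_action xi s \<otimes>\<^bsub>BijGroup ?E\<^esub> torus_action xi t"
      using mult by (auto simp: carrier_torus_group)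
  qed
  moreover have "inj_on (torus_action xi) (carrier torus_group)"
  proof (rule inj_onI)
    fix s t :: "(real^'n) set"
    assume st: "s \<in> carrier torus_group" "t \<in> carrier torus_group" "torus_action xi s = torus_action xi t"
    then obtain a b where ab: "s = torus_proj a" "t = torus_proj b"
      by (auto simp: carrier_torus_group)
    \<comment> \<open>Over the barycentre the torus acts freely.\<close>
    define x :: "real^'n" where "x = (\<chi> i. 1 / real CARD('n))"
    have x: "x \<in> std_simplex" by (simp add: mem_std_simplex x_def)
    have "L_class xi a x = L_class xi b x"
      using torus_action_L_class[OF x, of xi a 0] torus_action_L_class[OF x, of xi b 0] st(3) ab by simp
    then have "a - b \<in> isotropy xi x"
      by (simp add: L_class_eq_iff x)
    then obtain c where "\<forall>i. x $ i \<noteq> 0 \<longrightarrow> c i = 0" and c: "a - b - (\<Sum>i\<in>UNIV. c i *\<^sub>R real_vec (xi i)) \<in> range real_vec"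
      by (auto simp: isotropy_def)
    then have "\<forall>i. c i = 0" by (simp add: x_def)
    then show "s = t"
      using c ab by (simp add: torus_proj_eq_iff)
  qed
  ultimately show ?thesis
    by (simp add: faithful_action_def group_action_def faithful_action_axioms_def)
qed

text \<open>Over \<open>\<real>\<^sup>n\<^sup>+\<^sup>1\<close> the action is addition. The parametrisation of the product of torus and \<open>L\<close> is again
  a quotient map, because \<open>\<real>\<^sup>n\<^sup>+\<^sup>1\<close> is locally compact and the covering map of the torus is open.\<close>

lemma continuous_torus_action:
  "continuous_map (prod_topology torus (L_space xi)) (L_space xi) (\<lambda>(t, p). torus_action (xi :: 'n::finite \<Rightarrow> int^'n) t p)"
proof -
  let ?D = "top_of_set (std_simplex :: (real^'n) set)"
  let ?q = "\<lambda>(b, x). L_class xi b x"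
  have q: "quotient_map (prod_topology euclidean ?D) (L_space xi) ?q"
    using quotient_map_L_class[of "\<lambda>b. b"] by (simp add: linear_id[unfolded id_def])
  have "quotient_map (prod_topology euclidean (prod_topology euclidean ?D)) (prod_topology euclidean (L_space xi))
      (\<lambda>(a :: real^'n, p). (a, ?q p))"
    by (rule quotient_map_prod_right[OF _ _ q]) (simp_all add: locally_compact_space_euclidean)
  moreover have "quotient_map (prod_topology euclidean (L_space xi)) (prod_topology torus (L_space xi))
      (\<lambda>(a :: real^'n, p). (torus_proj a, p))"
  proof (rule continuous_open_imp_quotient_map)
    show "continuous_map (prod_topology euclidean (L_space xi)) (prod_topology torus (L_space xi)) (\<lambda>(a :: real^'n, p). (torus_proj a, p))"
      using quotient_imp_continuous_map[OF quotient_map_torus_proj]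
      by (auto simp: case_prod_unfold intro!: continuous_map_pairedI continuous_map_snd continuous_map_compose[OF continuous_map_fst, unfolded comp_def])
    show "open_map (prod_topology euclidean (L_space xi)) (prod_topology torus (L_space xi)) (\<lambda>(a :: real^'n, p). (torus_proj a, p))"
      unfolding open_map_def
    proof (intro allI impI)
      fix U :: "((real^'n) \<times> ((real^'n) set \<times> (real^'n)) set) set"
      assume U: "openin (prod_topology euclidean (L_space xi)) U"
      show "openin (prod_topology torus (L_space xi)) ((\<lambda>(a :: real^'n, p). (torus_proj a, p)) ` U)"
        unfolding openin_prod_topology_alt
      proof (intro allI impI)
        fix t p assume "(t, p) \<in> (\<lambda>(a :: real^'n, p). (torus_proj a, p)) ` U"
        then obtain a where a: "(a, p) \<in> U" "t = torus_proj a" by auto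
        then obtain V W where "open V" "openin (L_space xi) W" "a \<in> V" "p \<in> W" "V \<times> W \<subseteq> U"
          using U unfolding openin_prod_topology_alt by (metis open_openin)
        moreover have "torus_proj ` V \<times> W \<subseteq> (\<lambda>(a :: real^'n, p). (torus_proj a, p)) ` U"
          using \<open>V \<times> W \<subseteq> U\<close> by force
        moreover have "openin torus (torus_proj ` V)"
          using open_map_torus_proj \<open>open V\<close> by (auto simp: open_map_def)
        ultimately show "\<exists>V W. openin torus V \<and> openin (L_space xi) W \<and> t \<in> V \<and> p \<in> W \<and>
            V \<times> W \<subseteq> (\<lambda>(a :: real^'n, p). (torus_proj a, p)) ` U"
          using a(2) by blast
      qed
    qed
    show "(\<lambda>(a :: real^'n, p). (torus_proj a, p)) ` topspace (prod_topology euclidean (L_space xi)) = topspace (prod_topology torus (L_space xi))"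
      by (auto simp: topspace_torus)
  qed
  ultimately have quot: "quotient_map (prod_topology euclidean (prod_topology euclidean ?D)) (prod_topology torus (L_space xi))
      ((\<lambda>(a :: real^'n, p). (torus_proj a, p)) \<circ> (\<lambda>(a :: real^'n, p). (a, ?q p)))"
    by (rule quotient_map_compose)
  have "continuous_map (prod_topology euclidean (prod_topology euclidean ?D)) (prod_topology euclidean ?D)
     (\<lambda>(a :: real^'n, b, x). (a + b, x))"
    unfolding case_prod_unfold
    by (intro continuous_map_pairedI continuous_map_add continuous_map_fst
        continuous_map_compose[OF continuous_map_snd, unfolded comp_def]
        continuous_map_compose[OF continuous_map_snd continuous_map_fst, unfolded comp_def]
        continuous_map_compose[OF continuous_map_snd continuous_map_snd, unfolded comp_def])
  from continuous_map_compose[OF this quotient_imp_continuous_map[OF q]]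
  have "continuous_map (prod_topology euclidean (prod_topology euclidean ?D)) (L_space xi)
     ((\<lambda>(t, p). torus_action xi t p) \<circ> ((\<lambda>(a :: real^'n, p). (torus_proj a, p)) \<circ> (\<lambda>(a :: real^'n, p). (a, ?q p))))"
    by (rule continuous_map_eq) (auto simp: torus_action_L_class)
  then show ?thesis
    by (rule continuous_compose_quotient_map[OF quot])
qed


section \<open>Polar coordinates on the sphere\<close>

text \<open>The squared moduli of the coordinates of a point of the unit sphere are the barycentric
  coordinates \<open>x\<close> of a point of the simplex; the angles \<open>a\<close> are measured in full turns.\<close>

definition polar :: "real^'n \<Rightarrow> real^'n \<Rightarrow> complex^'n" where
  "polar a x = (\<chi> i. complex_of_real (sqrt (x $ i)) * cis (2 * pi * a $ i))"

definition rotate_by :: "real^'n \<Rightarrow> complex^'n \<Rightarrow> complex^'n" where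
  "rotate_by a z = (\<chi> i. cis (2 * pi * a $ i) * z $ i)"

lemma cis_2pi_eq_1_iff: "cis (2 * pi * a) = 1 \<longleftrightarrow> a \<in> \<int>"
proof -
  have "cis (2 * pi * a) = 1 \<longleftrightarrow> (\<exists>n::int. 2 * pi * a = of_int (2 * n) * pi)"
    unfolding cis_conv_exp exp_eq_1 by simp
  also have "\<dots> \<longleftrightarrow> (\<exists>n::int. a = of_int n)"
    by (simp add: mult.commute mult.left_commute)
  finally show ?thesis
    by (auto simp: Ints_def)
qed

lemma cis_2pi_eq_iff: "cis (2 * pi * a) = cis (2 * pi * b) \<longleftrightarrow> a - b \<in> \<int>"
proof -
  have "cis (2 * pi * a) = cis (2 * pi * b) \<longleftrightarrow> cis (2 * pi * a) / cis (2 * pi * b) = 1"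
    by (auto simp: divide_eq_1_iff cis_neq_zero)
  also have "\<dots> \<longleftrightarrow> cis (2 * pi * (a - b)) = 1"
    by (simp add: cis_divide right_diff_distrib)
  finally show ?thesis
    by (simp only: cis_2pi_eq_1_iff)
qed

lemma cmod_polar_nth: "x $ i \<ge> 0 \<Longrightarrow> cmod (polar a x $ i) = sqrt (x $ i)"
  by (simp add: polar_def norm_mult)

lemma norm_polar:
  assumes "x \<in> std_simplex"
  shows "norm (polar a x) = 1"
proof -
  have "(\<Sum>i\<in>UNIV. (cmod (polar a x $ i))\<^sup>2) = (\<Sum>i\<in>UNIV. x $ i)"
    using assms by (intro sum.cong) (auto simp: cmod_polar_nth mem_std_simplex)
  then show ?thesis
    using assms by (simp add: norm_vec_def L2_set_def mem_std_simplex)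
qed

lemma polar_nth_eq_0_iff: "polar a x $ i = 0 \<longleftrightarrow> x $ i = 0"
  by (simp add: polar_def cis_neq_zero)

lemma polar_eq_iff:
  assumes "x \<in> std_simplex" "y \<in> std_simplex"
  shows "polar a x = polar b y \<longleftrightarrow> x = y \<and> (\<forall>i. x $ i \<noteq> 0 \<longrightarrow> a $ i - b $ i \<in> \<int>)"
proof -
  have "x = y" if "polar a x = polar b y"
  proof -
    have "sqrt (x $ i) = sqrt (y $ i)" for i
      using assms cmod_polar_nth[of x i a] cmod_polar_nth[of y i b] that by (simp add: mem_std_simplex)
    then show ?thesis by (simp add: vec_eq_iff)
  qed
  moreover have "polar a x = polar b x \<longleftrightarrow> (\<forall>i. x $ i \<noteq> 0 \<longrightarrow> a $ i - b $ i \<in> \<int>)"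
    by (auto simp: polar_def vec_eq_iff cis_2pi_eq_iff)
  ultimately show ?thesis by blast
qed

lemma rotate_polar: "rotate_by a (polar b x) = polar (a + b) x"
  by (simp add: rotate_by_def polar_def vec_eq_iff cis_mult[symmetric] distrib_left)

lemma sphere_polar:
  assumes "z \<in> sphere (0 :: complex^'n::finite) 1"
  obtains a x where "x \<in> std_simplex" "a \<in> cbox (\<chi> i. -1) (\<chi> i. 1)" "z = polar a x"
proof -
  define x :: "real^'n" where "x = (\<chi> i. (cmod (z $ i))\<^sup>2)"
  define a :: "real^'n" where "a = (\<chi> i. Arg (z $ i) / (2 * pi))"
  have "(\<Sum>i\<in>UNIV. x $ i) = (norm z)\<^sup>2"
    by (simp add: x_def norm_vec_def L2_set_def real_sqrt_pow2 sum_nonneg)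
  then have "x \<in> std_simplex"
    using assms by (simp add: mem_std_simplex x_def)
  moreover have "\<bar>a $ i\<bar> \<le> 1" for i
  proof -
    have "\<bar>Arg (z $ i)\<bar> \<le> 2 * pi"
      using Arg_bounded[of "z $ i"] pi_gt_zero by linarith
    then show ?thesis by (simp add: a_def)
  qed
  then have "a \<in> cbox (\<chi> i. -1) (\<chi> i. 1)"
    by (simp add: mem_box_cart abs_le_iff minus_le_iff)
  moreover have "z $ i = polar a x $ i" for i
    using rcis_cmod_Arg[of "z $ i"] by (simp add: polar_def x_def a_def rcis_def)
  then have "z = polar a x" by (simp add: vec_eq_iff)
  ultimately show thesis by (rule that)
qed

lemma continuous_polar: "continuous_on UNIV (\<lambda>(a, x :: real^'n::finite). polar a x)"
  unfolding polar_def case_prod_unfold by (intro continuous_intros)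

lemma quotient_map_polar:
  "quotient_map (prod_topology euclidean (top_of_set std_simplex)) (top_of_set (sphere (0 :: complex^'n::finite) 1))
     (\<lambda>(a, x). polar a x)"
proof (rule quotient_map_if_compact_surj)
  let ?K = "cbox (\<chi> i. -1) (\<chi> i. 1) \<times> (std_simplex :: (real^'n) set)"
  show "continuous_map (prod_topology euclidean (top_of_set std_simplex)) (top_of_set (sphere (0 :: complex^'n::finite) 1))
     (\<lambda>(a, x). polar a x)"
    using continuous_on_subset[OF continuous_polar subset_UNIV]
    by (auto simp: prod_topology_subtopology continuous_map_in_subtopology norm_polar
        subtopology_UNIV[symmetric] simp del: subtopology_UNIV)
  show "compactin (prod_topology euclidean (top_of_set std_simplex)) ?K"
    by (auto simp: compactin_Times compactin_subtopology compact_std_simplex compact_cbox)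
  show "(\<lambda>(a, x). polar a x) ` ?K = topspace (top_of_set (sphere 0 1))"
  proof (intro equalityI subsetI)
    fix z assume "z \<in> topspace (top_of_set (sphere (0 :: complex^'n) 1))"
    then show "z \<in> (\<lambda>(a, x). polar a x) ` ?K"
      using sphere_polar[of z] by (metis (no_types, lifting) SigmaI case_prod_conv image_eqI topspace_euclidean_subtopology)
  qed (auto simp: norm_polar)
qed (simp add: Hausdorff_space_subtopology)


section \<open>Maximal rank\<close>

text \<open>In coordinates with respect to \<open>b\<close>, passing to the quotient by the torus of the face of \<open>x\<close>
  means forgetting the coordinates \<open>i\<close> with \<open>x $ i = 0\<close>. The vectors \<open>w\<close> are needed since the
  \<open>b i\<close> may generate a proper sublattice of the integer vectors.\<close>

lemma isotropy_lincomb_iff: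
  fixes xi b :: "'n::finite \<Rightarrow> int^'n"
  assumes b: "\<forall>i. x $ i = 0 \<longrightarrow> b i = xi i"
  shows "(\<Sum>i\<in>UNIV. (a $ i) *\<^sub>R real_vec (b i)) \<in> isotropy xi x \<longleftrightarrow>
    (\<exists>w. (\<Sum>i\<in>UNIV. (w $ i) *\<^sub>R real_vec (b i)) \<in> range real_vec \<and> (\<forall>i. x $ i \<noteq> 0 \<longrightarrow> a $ i - w $ i \<in> \<int>))"
    (is "?A \<longleftrightarrow> ?B")
proof
  have sum_eq: "(\<Sum>i\<in>UNIV. c i *\<^sub>R real_vec (xi i)) = (\<Sum>i\<in>UNIV. c i *\<^sub>R real_vec (b i))"
    if "\<forall>i. x $ i \<noteq> 0 \<longrightarrow> c i = 0" for c
    using that b by (intro sum.cong) force+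
  {
    assume ?A
    then obtain c where c: "\<forall>i. x $ i \<noteq> 0 \<longrightarrow> c i = 0"
      and "(\<Sum>i\<in>UNIV. (a $ i) *\<^sub>R real_vec (b i)) - (\<Sum>i\<in>UNIV. c i *\<^sub>R real_vec (xi i)) \<in> range real_vec"
      by (auto simp: isotropy_def)
    then have "(\<Sum>i\<in>UNIV. ((a - (\<chi> i. c i)) $ i) *\<^sub>R real_vec (b i)) \<in> range real_vec"
      by (simp add: sum_eq scaleR_left_diff_distrib sum_subtractf)
    then show ?B
      by (intro exI[of _ "a - (\<chi> i. c i)"]) (simp add: c)
  next
    assume ?B
    then obtain w where w: "(\<Sum>i\<in>UNIV. (w $ i) *\<^sub>R real_vec (b i)) \<in> range real_vec"
      "\<forall>i. x $ i \<noteq> 0 \<longrightarrow> a $ i - w $ i \<in> \<int>" by blast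
    define m where "m i = (if x $ i = 0 then 0 else \<lfloor>a $ i - w $ i\<rfloor>)" for i
    define c where "c i = (if x $ i = 0 then a $ i - w $ i else 0)" for i
    have a: "a $ i - c i = w $ i + of_int (m i)" for i
      using w(2) by (auto simp: m_def c_def of_int_floor_cancel[THEN iffD2])
    have "(\<Sum>i\<in>UNIV. (a $ i) *\<^sub>R real_vec (b i)) - (\<Sum>i\<in>UNIV. c i *\<^sub>R real_vec (xi i))
      = (\<Sum>i\<in>UNIV. (a $ i - c i) *\<^sub>R real_vec (b i))"
      by (simp add: sum_eq c_def scaleR_left_diff_distrib sum_subtractf)
    also have "\<dots> = (\<Sum>i\<in>UNIV. (w $ i) *\<^sub>R real_vec (b i)) + real_vec (\<Sum>i\<in>UNIV. m i *s b i)"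
      unfolding a by (simp add: scaleR_left_distrib sum.distrib real_vec_sum real_vec_smult)
    also have "\<dots> \<in> range real_vec"
      using w(1) by (auto simp flip: real_vec_add)
    finally show ?A
      unfolding isotropy_def by (intro CollectI exI[of _ c]) (simp add: c_def)
  }
qed

lemma lincomb_diff:
  fixes a b :: "real^'n::finite" and f :: "'n \<Rightarrow> 'b::real_vector"
  shows "(\<Sum>i\<in>UNIV. (a $ i) *\<^sub>R f i) - (\<Sum>i\<in>UNIV. (b $ i) *\<^sub>R f i) = (\<Sum>i\<in>UNIV. ((a - b) $ i) *\<^sub>R f i)"
  by (simp add: scaleR_left_diff_distrib sum_subtractf)

text \<open>The angle \<open>a $ i\<close> is lost in \<open>polar a x\<close> exactly if \<open>x $ i = 0\<close>, and it is lost in \<open>L\<close>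
  exactly if the face of \<open>x\<close> is contained in the facet \<open>i\<close>.\<close>

lemma L_class_polar_same_kernel:
  fixes xi b :: "'n::finite \<Rightarrow> int^'n"
  assumes basis: "lattice_basis b"
    and b: "\<forall>i. x $ i = 0 \<longrightarrow> b i = xi i"
    and xy: "x \<in> std_simplex" "y \<in> std_simplex"
  shows "L_class xi (\<Sum>i\<in>UNIV. (a $ i) *\<^sub>R real_vec (b i)) x = L_class xi (\<Sum>i\<in>UNIV. (a' $ i) *\<^sub>R real_vec (b i)) y
    \<longleftrightarrow> polar a x = polar a' y"
proof -
  have *: "(\<exists>w. (\<forall>i. w $ i \<in> \<int>) \<and> (\<forall>i. x $ i \<noteq> 0 \<longrightarrow> (a - a') $ i - w $ i \<in> \<int>)) \<longleftrightarrow>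
     (\<forall>i. x $ i \<noteq> 0 \<longrightarrow> (a - a') $ i \<in> \<int>)" (is "?L \<longleftrightarrow> ?R")
  proof
    assume ?L
    then obtain w where w: "\<forall>i. w $ i \<in> \<int>" "\<forall>i. x $ i \<noteq> 0 \<longrightarrow> (a - a') $ i - w $ i \<in> \<int>" by blast
    show ?R
    proof (intro allI impI)
      fix i assume "x $ i \<noteq> 0"
      then show "(a - a') $ i \<in> \<int>"
        using Ints_add[OF w(2)[rule_format, of i] w(1)[rule_format, of i]] by simp
    qed
  next
    assume ?R
    then show ?L by (intro exI[of _ 0]) simp
  qed
  have "(\<Sum>i\<in>UNIV. ((a - a') $ i) *\<^sub>R real_vec (b i)) \<in> isotropy xi x \<longleftrightarrow>
     (\<forall>i. x $ i \<noteq> 0 \<longrightarrow> (a - a') $ i \<in> \<int>)"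
    unfolding isotropy_lincomb_iff[OF b] lincomb_lattice_iff[OF basis] by (rule *)
  then show ?thesis
    unfolding L_class_eq_iff[OF xy] polar_eq_iff[OF xy] lincomb_diff by simp
qed

lemma quotient_map_L_class_lincomb:
  fixes xi b :: "'n::finite \<Rightarrow> int^'n"
  assumes indep: "lin_indep b"
  shows "quotient_map (prod_topology euclidean (top_of_set std_simplex)) (L_space xi)
    (\<lambda>(a, x). L_class xi (\<Sum>i\<in>UNIV. (a $ i) *\<^sub>R real_vec (b i)) x)"
  using quotient_map_L_class[OF linear_lincomb surj_lincomb[OF indep], where xi = xi] .

lemma L_homeomorphic_sphere_if_basis:
  fixes xi :: "'n::finite \<Rightarrow> int^'n"
  assumes basis: "lattice_basis xi"
  shows "L_space xi homeomorphic_space top_of_set (sphere (0::complex^'n) 1)"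
proof (rule homeomorphic_quotients[OF quotient_map_L_class_lincomb quotient_map_polar])
  show "lin_indep xi"
    using basis by (simp add: lattice_basis_def)
next
  fix p q :: "(real^'n) \<times> (real^'n)"
  assume pq: "p \<in> topspace (prod_topology euclidean (top_of_set std_simplex))"
    "q \<in> topspace (prod_topology euclidean (top_of_set std_simplex))"
  obtain a x b y where "p = (a, x)" "q = (b, y)" by (metis surj_pair)
  with pq show "(case p of (a, x) \<Rightarrow> L_class xi (\<Sum>i\<in>UNIV. (a $ i) *\<^sub>R real_vec (xi i)) x)
      = (case q of (a, x) \<Rightarrow> L_class xi (\<Sum>i\<in>UNIV. (a $ i) *\<^sub>R real_vec (xi i)) x)
    \<longleftrightarrow> (case p of (a, x) \<Rightarrow> polar a x) = (case q of (a, x) \<Rightarrow> polar a x)"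
    by (simp add: L_class_polar_same_kernel[OF basis])
qed


section \<open>The orbit space of the sphere\<close>

lemma rotate_by_add: "rotate_by a (rotate_by b z) = rotate_by (a + b) z"
  by (simp add: rotate_by_def vec_eq_iff cis_mult[symmetric] distrib_left)

lemma rotate_by_int: "(\<forall>i. a $ i \<in> \<int>) \<Longrightarrow> rotate_by a z = z"
  using cis_2pi_eq_1_iff by (simp add: rotate_by_def vec_eq_iff)

lemma carrier_quotient_lattice: "carrier (quotient_lattice xi) = range (\<lambda>v. int_vec.span (range xi) #>\<^bsub>additive_group\<^esub> v)"
  by (auto simp: quotient_lattice_def FactGroup_def RCOSETS_def)

text \<open>Another representative of the class of \<open>v\<close> has coordinates that differ from \<open>a\<close> by integers,
  and these act trivially.\<close>

lemma sphere_action_eq: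
  fixes xi :: "'n::finite \<Rightarrow> int^'n"
  assumes indep: "lin_indep xi"
    and z: "z \<in> sphere 0 1" and a: "(\<Sum>i\<in>UNIV. (a $ i) *\<^sub>R real_vec (xi i)) = real_vec v"
  shows "sphere_action xi (int_vec.span (range xi) #>\<^bsub>additive_group\<^esub> v) z = rotate_by a z"
proof -
  let ?C = "int_vec.span (range xi) #>\<^bsub>additive_group\<^esub> v"
  have "(THE w. \<exists>u \<in> ?C. \<exists>x :: real^'n. real_vec u = (\<Sum>i\<in>UNIV. (x $ i) *\<^sub>R real_vec (xi i)) \<and>
        w = (\<chi> i. cis (2 * pi * (x $ i)) * z $ i)) = rotate_by a z"
  proof (rule the_equality)
    have "v \<in> ?C"
      using int_vec.span_zero by (auto simp: coset_additive_group image_iff intro!: bexI[of _ 0])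
    then show "\<exists>u \<in> ?C. \<exists>x :: real^'n. real_vec u = (\<Sum>i\<in>UNIV. (x $ i) *\<^sub>R real_vec (xi i)) \<and>
        rotate_by a z = (\<chi> i. cis (2 * pi * (x $ i)) * z $ i)"
      using a by (intro bexI[of _ v] exI[of _ a]) (simp_all add: rotate_by_def)
  next
    fix w
    assume "\<exists>u \<in> ?C. \<exists>x :: real^'n. real_vec u = (\<Sum>i\<in>UNIV. (x $ i) *\<^sub>R real_vec (xi i)) \<and>
        w = (\<chi> i. cis (2 * pi * (x $ i)) * z $ i)"
    then obtain s x where s: "s \<in> int_vec.span (range xi)"
      and x: "real_vec (s + v) = (\<Sum>i\<in>UNIV. (x $ i) *\<^sub>R real_vec (xi i))"
      and w: "w = rotate_by x z"
      by (auto simp: coset_additive_group rotate_by_def)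
    obtain m where m: "s = (\<Sum>i\<in>UNIV. m i *s xi i)"
      using int_span_family[OF finite s] by blast
    then have s_eq: "real_vec s = (\<Sum>i\<in>UNIV. of_int (m i) *\<^sub>R real_vec (xi i))"
      by (simp add: real_vec_sum real_vec_smult)
    have "(\<Sum>i\<in>UNIV. (x $ i - (a $ i + of_int (m i))) *\<^sub>R real_vec (xi i)) = real_vec (s + v) - (real_vec v + real_vec s)"
      unfolding x a[symmetric] s_eq
      by (simp add: scaleR_left_diff_distrib scaleR_left_distrib sum_subtractf sum.distrib)
    also have "\<dots> = 0"
      by (simp add: real_vec_add)
    finally have "x $ i - (a $ i + of_int (m i)) = 0" for i
      by (rule lin_indepD[OF indep])
    then have "x = (\<chi> i. of_int (m i)) + a"
      by (simp add: vec_eq_iff algebra_simps)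
    then have "rotate_by x z = rotate_by (\<chi> i. of_int (m i)) (rotate_by a z)"
      by (simp add: rotate_by_add)
    then show "w = rotate_by a z"
      by (simp add: w rotate_by_int)
  qed
  then show ?thesis
    using z by (simp add: sphere_action_def)
qed

lemma orbit_sphere_action:
  fixes xi :: "'n::finite \<Rightarrow> int^'n"
  assumes indep: "lin_indep xi"
    and z: "z \<in> sphere 0 1"
  shows "orbit (quotient_lattice xi) (sphere_action xi) z
    = {rotate_by a z | a. (\<Sum>i\<in>UNIV. (a $ i) *\<^sub>R real_vec (xi i)) \<in> range real_vec}"
proof (intro equalityI subsetI)
  fix w assume "w \<in> orbit (quotient_lattice xi) (sphere_action xi) z"
  then obtain v where w: "w = sphere_action xi (int_vec.span (range xi) #>\<^bsub>additive_group\<^esub> v) z"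
    by (auto simp: orbit_def carrier_quotient_lattice)
  obtain a where a: "real_vec v = (\<Sum>i\<in>UNIV. (a $ i) *\<^sub>R real_vec (xi i))"
    using surj_lincomb[OF indep] by (meson surjD)
  then show "w \<in> {rotate_by a z | a. (\<Sum>i\<in>UNIV. (a $ i) *\<^sub>R real_vec (xi i)) \<in> range real_vec}"
    using sphere_action_eq[OF indep z a[symmetric]] w by (metis (mono_tags, lifting) mem_Collect_eq rangeI)
next
  fix w assume "w \<in> {rotate_by a z | a. (\<Sum>i\<in>UNIV. (a $ i) *\<^sub>R real_vec (xi i)) \<in> range real_vec}"
  then obtain a v where "w = rotate_by a z" "(\<Sum>i\<in>UNIV. (a $ i) *\<^sub>R real_vec (xi i)) = real_vec v" by auto
  then have "w = sphere_action xi (int_vec.span (range xi) #>\<^bsub>additive_group\<^esub> v) z"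
    using sphere_action_eq[OF indep z] by simp
  then show "w \<in> orbit (quotient_lattice xi) (sphere_action xi) z"
    by (auto simp: orbit_def carrier_quotient_lattice)
qed

text \<open>The rotations coming from the quotient lattice are those by the coordinates \<open>w\<close> of integer vectors,
  which is also the ambiguity of the coordinates of a point of the torus.\<close>

lemma orbit_polar_eq_iff:
  fixes xi :: "'n::finite \<Rightarrow> int^'n"
  assumes indep: "lin_indep xi"
    and xy: "x \<in> std_simplex" "y \<in> std_simplex"
  shows "orbit (quotient_lattice xi) (sphere_action xi) (polar a x) = orbit (quotient_lattice xi) (sphere_action xi) (polar b y)
     \<longleftrightarrow> x = y \<and> (\<exists>w. (\<Sum>i\<in>UNIV. (w $ i) *\<^sub>R real_vec (xi i)) \<in> range real_vec \<and>
            (\<forall>i. x $ i \<noteq> 0 \<longrightarrow> (a - b) $ i - w $ i \<in> \<int>))"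
proof -
  let ?O = "\<lambda>a x. orbit (quotient_lattice xi) (sphere_action xi) (polar a x)"
  define G where "G = {w :: real^'n. (\<Sum>i\<in>UNIV. (w $ i) *\<^sub>R real_vec (xi i)) \<in> range real_vec}"
  have G_diff: "v - w \<in> G" if "v \<in> G" "w \<in> G" for v w
    using that unfolding G_def mem_Collect_eq lincomb_diff[symmetric]
    by (auto simp flip: real_vec_diff)
  have G_0: "0 \<in> G"
    by (simp add: G_def image_iff) (metis real_vec_0)
  have O: "?O a x = {polar (w + a) x | w. w \<in> G}" if "x \<in> std_simplex" for a x
    using orbit_sphere_action[OF indep, where z = "polar a x"] that by (simp add: norm_polar rotate_polar G_def)
  have "?O a x = ?O b y \<longleftrightarrow> (\<exists>w\<in>G. polar a x = polar (w + b) y)"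
  proof
    assume "?O a x = ?O b y"
    moreover have "polar a x \<in> ?O a x"
      unfolding O[OF xy(1)] using G_0 by force
    ultimately show "\<exists>w\<in>G. polar a x = polar (w + b) y"
      unfolding O[OF xy(2)] by blast
  next
    assume "\<exists>w\<in>G. polar a x = polar (w + b) y"
    then obtain w where w: "w \<in> G" "polar a x = polar (w + b) y" by blast
    have shift: "polar (v + a) x = polar ((v + w) + b) y" for v
      using arg_cong[OF w(2), of "rotate_by v"] by (simp add: rotate_polar add.assoc)
    have "v + w \<in> G" if "v \<in> G" for v
      using G_diff[OF that G_diff[OF G_0 w(1)]] by simp
    then have "?O a x \<subseteq> ?O b y"
      unfolding O[OF xy(1)] O[OF xy(2)] using shift by blast
    moreover have "polar (v + b) y = polar ((v - w) + a) x" for v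
      by (simp add: shift)
    then have "?O b y \<subseteq> ?O a x"
      unfolding O[OF xy(1)] O[OF xy(2)] using G_diff[OF _ w(1)] by blast
    ultimately show "?O a x = ?O b y" by blast
  qed
  then show ?thesis
    unfolding polar_eq_iff[OF xy] by (auto simp: G_def algebra_simps)
qed

lemma L_homeomorphic_sphere_orbit_space:
  fixes xi :: "'n::finite \<Rightarrow> int^'n"
  assumes indep: "lin_indep xi"
  shows "L_space xi homeomorphic_space
    orbit_space (quotient_lattice xi) (top_of_set (sphere (0::complex^'n) 1)) (sphere_action xi)"
proof (rule homeomorphic_quotients[OF quotient_map_L_class_lincomb[OF indep]])
  show "quotient_map (prod_topology euclidean (top_of_set std_simplex))
     (orbit_space (quotient_lattice xi) (top_of_set (sphere (0::complex^'n) 1)) (sphere_action xi))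
     (orbit (quotient_lattice xi) (sphere_action xi) \<circ> (\<lambda>(a, x). polar a x))"
    unfolding orbit_space_def
    by (rule quotient_map_compose[OF quotient_map_polar quotient_map_quotient_topology])
next
  fix p q :: "(real^'n) \<times> (real^'n)"
  let ?O = "orbit (quotient_lattice xi) (sphere_action xi)"
  assume pq: "p \<in> topspace (prod_topology euclidean (top_of_set std_simplex))"
    "q \<in> topspace (prod_topology euclidean (top_of_set std_simplex))"
  obtain a x b y where pq_eq: "p = (a, x)" "q = (b, y)" by (metis surj_pair)
  with pq have xy: "x \<in> std_simplex" "y \<in> std_simplex" by auto
  have "L_class xi (\<Sum>i\<in>UNIV. (a $ i) *\<^sub>R real_vec (xi i)) x = L_class xi (\<Sum>i\<in>UNIV. (b $ i) *\<^sub>R real_vec (xi i)) y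
    \<longleftrightarrow> ?O (polar a x) = ?O (polar b y)"
    unfolding L_class_eq_iff[OF xy] lincomb_diff isotropy_lincomb_iff[of x xi xi, OF allI[OF impI[OF refl]]] orbit_polar_eq_iff[OF indep xy] ..
  then show "(case p of (a, x) \<Rightarrow> L_class xi (\<Sum>i\<in>UNIV. (a $ i) *\<^sub>R real_vec (xi i)) x)
      = (case q of (a, x) \<Rightarrow> L_class xi (\<Sum>i\<in>UNIV. (a $ i) *\<^sub>R real_vec (xi i)) x)
    \<longleftrightarrow> (?O \<circ> (\<lambda>(a, x). polar a x)) p = (?O \<circ> (\<lambda>(a, x). polar a x)) q"
    by (simp add: pq_eq)
qed


section \<open>The sphere as a manifold\<close>

lemma subspace_homeomorphic_Euclidean_space:
  fixes T :: "'a::euclidean_space set"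
  assumes "subspace T"
  shows "top_of_set T homeomorphic_space Euclidean_space (dim T)"
proof -
  obtain B where B: "B \<subseteq> T" "pairwise orthogonal B" "\<And>x. x \<in> B \<Longrightarrow> norm x = 1"
      "independent B" "card B = dim T" "span B = T"
    using orthonormal_basis_subspace[OF assms] by blast
  have "finite B" using B(4) by (rule independent_imp_finite)
  obtain b where b: "bij_betw b {..<dim T} B"
    using ex_bij_betw_nat_finite[OF \<open>finite B\<close>] B(5) by (auto simp: lessThan_atLeast0)
  define f where "f x = (\<Sum>i<dim T. x i *\<^sub>R b i)" for x
  define g where "g y = (\<lambda>i. if i < dim T then y \<bullet> b i else 0)" for y
  have inner: "b i \<bullet> b j = (if i = j then 1 else 0)" if "i < dim T" "j < dim T" for i j
  proof (cases "i = j")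
    case True
    then show ?thesis
      using that b B(3)[of "b i"] by (auto simp: bij_betw_def dot_square_norm)
  next
    case False
    then have "b i \<noteq> b j"
      using that b by (auto simp: bij_betw_def inj_on_eq_iff)
    then show ?thesis
      using that b B(2) False by (auto simp: bij_betw_def pairwise_def orthogonal_def)
  qed
  have fT: "f x \<in> T" for x
    unfolding f_def using b B(1) assms
    by (intro subspace_sum subspace_scale) (auto simp: bij_betw_def)
  have f_inner: "f x \<bullet> b j = x j" if "j < dim T" for x j
  proof -
    have "f x \<bullet> b j = (\<Sum>i<dim T. if i = j then x j else 0)"
      unfolding f_def inner_sum_left using that by (intro sum.cong) (auto simp: inner)
    then show ?thesis using that by simp
  qed
  have gf: "g (f x) = x" if "x \<in> topspace (Euclidean_space (dim T))" for x
    using that by (auto simp: g_def f_inner topspace_Euclidean_space)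
  have fg: "f (g y) = y" if "y \<in> T" for y
  proof -
    have "(f (g y) - y) \<bullet> b j = 0" if "j < dim T" for j
      using that by (simp add: inner_diff_left f_inner) (simp add: g_def)
    then have "\<forall>v\<in>B. orthogonal (f (g y) - y) v"
      using b by (auto simp: orthogonal_def bij_betw_def)
    then have "orthogonal (f (g y) - y) (f (g y) - y)"
      using orthogonal_to_span[of "f (g y) - y" B] assms fT that B(6) by (simp add: subspace_diff)
    then show ?thesis by (simp add: orthogonal_self)
  qed
  have "continuous_map (top_of_set T) (Euclidean_space (dim T)) g"
    unfolding g_def by (subst continuous_map_componentwise_Euclidean_space) (auto intro!: continuous_intros)
  moreover have "continuous_map (Euclidean_space (dim T)) (top_of_set T) f"
    unfolding continuous_map_in_subtopology
  proof
    show "continuous_map (Euclidean_space (dim T)) euclidean f"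
      unfolding continuous_map_Euclidean_space_iff f_def
      by (intro continuous_intros) (auto intro: continuous_on_subset[OF continuous_on_product_coordinates])
  qed (use fT in auto)
  ultimately have "homeomorphic_maps (top_of_set T) (Euclidean_space (dim T)) g f"
    by (auto simp: homeomorphic_maps_def fg gf)
  then show ?thesis
    by (auto simp: homeomorphic_space_def)
qed

text \<open>A coordinate \<open>k\<close> other than \<open>j\<close> provides a point of the sphere from which to project
  stereographically.\<close>

lemma sphere_nonzero_coordinate_chart:
  fixes j :: "'n::finite"
  assumes "CARD('n) = n + 1" "n \<ge> 1"
  obtains V where "openin (Euclidean_space (2 * n + 1)) V"
    "top_of_set {z \<in> sphere (0 :: complex^'n) 1. z $ j \<noteq> 0} homeomorphic_space subtopology (Euclidean_space (2 * n + 1)) V"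
proof -
  have "\<exists>k. k \<noteq> j"
  proof (rule ccontr)
    assume "\<not> ?thesis"
    then have "(UNIV :: 'n set) = {j}" by auto
    then have "CARD('n) = 1" by (metis card_1_singleton_iff One_nat_def)
    then show False using assms by simp
  qed
  then obtain k where k: "k \<noteq> j" by blast
  let ?p = "axis k 1 :: complex^'n"
  let ?S = "sphere (0 :: complex^'n) 1"
  have p: "?p \<in> ?S" "?p \<noteq> 0" by (auto simp: norm_axis_1 axis_eq_0_iff)
  have dim: "dim {x. ?p \<bullet> x = 0} = 2 * n + 1"
    using dim_hyperplane[OF p(2)] assms(1) by simp
  have "(?S - {?p}) homeomorphic {x. ?p \<bullet> x = 0}"
    by (rule homeomorphic_punctured_sphere_hyperplane) (use p in auto)
  then have "top_of_set (?S - {?p}) homeomorphic_space top_of_set {x. ?p \<bullet> x = 0}"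
    by (rule homeomorphic_imp_homeomorphic_space)
  also have "\<dots> homeomorphic_space Euclidean_space (2 * n + 1)"
    using subspace_homeomorphic_Euclidean_space[OF subspace_hyperplane[of ?p]] dim by simp
  finally have hom: "top_of_set (?S - {?p}) homeomorphic_space Euclidean_space (2 * n + 1)" .
  have "open {z :: complex^'n. z $ j \<noteq> 0}"
    by (intro open_Collect_neq continuous_intros)
  then have "openin (top_of_set (?S - {?p})) ((?S - {?p}) \<inter> {z. z $ j \<noteq> 0})"
    by (rule openin_open_Int)
  moreover have "(?S - {?p}) \<inter> {z. z $ j \<noteq> 0} = {z \<in> ?S. z $ j \<noteq> 0}"
    using k by (auto simp: axis_def)
  ultimately have "openin (top_of_set (?S - {?p})) {z \<in> ?S. z $ j \<noteq> 0}" by simp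
  from openin_homeomorphic_image[OF hom this]
  obtain V where V: "openin (Euclidean_space (2 * n + 1)) V"
    "subtopology (top_of_set (?S - {?p})) {z \<in> ?S. z $ j \<noteq> 0} homeomorphic_space subtopology (Euclidean_space (2 * n + 1)) V"
    by blast
  moreover have "subtopology (top_of_set (?S - {?p})) {z \<in> ?S. z $ j \<noteq> 0} = top_of_set {z \<in> ?S. z $ j \<noteq> 0}"
    using k by (simp add: subtopology_subtopology) (rule arg_cong[where f = top_of_set], auto simp: axis_def)
  ultimately show thesis using that by simp
qed


section \<open>\<open>L\<close> as a manifold\<close>

definition L_chart :: "('n \<Rightarrow> int^'n) \<Rightarrow> 'n::finite \<Rightarrow> ((real^'n) set \<times> (real^'n)) set set" where
  "L_chart xi j = {L_class xi a x | a x. x \<in> std_simplex \<and> x $ j \<noteq> 0}"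

lemma L_class_mem_chart_iff:
  "x \<in> std_simplex \<Longrightarrow> L_class xi a x \<in> L_chart xi j \<longleftrightarrow> x $ j \<noteq> 0"
  by (auto simp: L_chart_def L_class_eq_iff)

lemma topspace_L_space_charts: "topspace (L_space xi) = (\<Union>j. L_chart xi j)"
proof (intro equalityI subsetI)
  fix p assume "p \<in> topspace (L_space xi)"
  then obtain a x where p: "p = L_class xi a x" "x \<in> std_simplex"
    by (auto simp: topspace_L_space)
  obtain j where "x $ j > 0"
    using std_simplex_pos_coordinate[OF p(2)] .
  then show "p \<in> (\<Union>j. L_chart xi j)"
    using p by (auto simp: L_class_mem_chart_iff intro!: exI[of _ j])
qed (auto simp: L_chart_def topspace_L_space)

lemma quotient_map_L_class_id:
  "quotient_map (prod_topology euclidean (top_of_set std_simplex)) (L_space xi) (\<lambda>(b, x). L_class xi b x)"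
  using quotient_map_L_class[of "\<lambda>b. b"] by (simp add: linear_id[unfolded id_def])

lemma openin_nonzero_coordinate:
  fixes j :: "'n::finite"
  shows "openin (prod_topology (euclidean :: (real^'n::finite) topology) (top_of_set std_simplex)) (UNIV \<times> {x \<in> std_simplex. x $ j \<noteq> 0})"
proof -
  have "open {x :: real^'n. x $ j \<noteq> 0}"
    by (intro open_Collect_neq continuous_intros)
  then have "openin (top_of_set std_simplex) (std_simplex \<inter> {x. x $ j \<noteq> 0})"
    by (rule openin_open_Int)
  moreover have "std_simplex \<inter> {x :: real^'n. x $ j \<noteq> 0} = {x \<in> std_simplex. x $ j \<noteq> 0}" by auto
  ultimately show ?thesis by (simp add: openin_prod_Times_iff)
qed

lemma openin_L_chart: "openin (L_space xi) (L_chart xi j)"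
proof -
  have sub: "L_chart xi j \<subseteq> topspace (L_space xi)"
    using topspace_L_space_charts by blast
  have preimage: "{p \<in> topspace (prod_topology euclidean (top_of_set std_simplex)). (\<lambda>(b, x). L_class xi b x) p \<in> L_chart xi j}
     = UNIV \<times> {x \<in> std_simplex. x $ j \<noteq> 0}"
    by (auto simp: L_class_mem_chart_iff)
  show ?thesis
    using quotient_map_L_class_id[of xi, unfolded quotient_map_def, THEN conjunct2, rule_format, OF sub]
      openin_nonzero_coordinate[of j]
    unfolding preimage by simp
qed

text \<open>Over the complement of the facet \<open>j\<close>, only the vectors \<open>xi i\<close> with \<open>i \<noteq> j\<close> matter, and
  these can be completed to a basis of the lattice; so there \<open>L\<close> looks as if \<open>xi\<close> were a basis.\<close>

lemma L_chart_homeomorphic_sphere_part: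
  fixes xi :: "'n::finite \<Rightarrow> int^'n"
  assumes "hyper_characteristic xi"
  shows "subtopology (L_space xi) (L_chart xi j) homeomorphic_space top_of_set {z \<in> sphere (0 :: complex^'n) 1. z $ j \<noteq> 0}"
proof -
  obtain b where b: "\<And>i. i \<noteq> j \<Longrightarrow> b i = xi i"
    and basis: "lattice_basis b"
    using hyper_characteristic_adapted_basis[OF assms] by blast
  then have indep: "lin_indep b"
    by (simp add: lattice_basis_def)
  let ?X = "prod_topology (euclidean :: (real^'n) topology) (top_of_set (std_simplex :: (real^'n) set))"
  let ?f = "\<lambda>(a, x). L_class xi (\<Sum>i\<in>UNIV. (a $ i) *\<^sub>R real_vec (b i)) x"
  let ?g = "\<lambda>(a, x). polar a x"
  let ?U = "UNIV \<times> {x \<in> std_simplex. x $ j \<noteq> 0}"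
  let ?V = "{z \<in> sphere (0 :: complex^'n) 1. z $ j \<noteq> 0}"
  have f: "quotient_map (subtopology ?X ?U) (subtopology (L_space xi) (L_chart xi j)) ?f"
    by (rule quotient_map_restriction[OF quotient_map_L_class_lincomb[OF indep]])
      (auto simp: L_class_mem_chart_iff openin_L_chart)
  have "openin (top_of_set (sphere 0 1)) (sphere 0 1 \<inter> {z :: complex^'n. z $ j \<noteq> 0})"
    by (intro openin_open_Int open_Collect_neq continuous_intros)
  then have "openin (top_of_set (sphere 0 1)) ?V"
    by (rule back_subst[of "openin _"]) auto
  then have "quotient_map (subtopology ?X ?U) (subtopology (top_of_set (sphere 0 1)) ?V) ?g"
    by (intro quotient_map_restriction[OF quotient_map_polar])
      (auto simp: polar_nth_eq_0_iff norm_polar)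
  moreover have "subtopology (top_of_set (sphere 0 1)) ?V = top_of_set ?V"
    by (simp add: subtopology_subtopology) (rule arg_cong[where f = top_of_set], auto)
  ultimately have g: "quotient_map (subtopology ?X ?U) (top_of_set ?V) ?g" by simp
  show ?thesis
  proof (rule homeomorphic_quotients[OF f g])
    fix p q assume pq: "p \<in> topspace (subtopology ?X ?U)" "q \<in> topspace (subtopology ?X ?U)"
    obtain a x a' y where pq_eq: "p = (a, x)" "q = (a', y)" by (metis surj_pair)
    with pq have xy: "x \<in> std_simplex" "y \<in> std_simplex" "x $ j \<noteq> 0" by auto
    have "\<forall>i. x $ i = 0 \<longrightarrow> b i = xi i"
      using xy(3) b by metis
    then show "?f p = ?f q \<longleftrightarrow> ?g p = ?g q"
      unfolding pq_eq prod.case by (rule L_class_polar_same_kernel[OF basis _ xy(1,2)])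
  qed
qed

text \<open>Points over distinct points of the simplex are separated by the projection to it, points over
  the same point lie in a common chart.\<close>

lemma Hausdorff_L_space:
  fixes xi :: "'n::finite \<Rightarrow> int^'n"
  assumes xi: "hyper_characteristic xi"
  shows "Hausdorff_space (L_space xi)"
  unfolding Hausdorff_space_def
proof (intro allI impI)
  fix p q assume pq: "p \<in> topspace (L_space xi) \<and> q \<in> topspace (L_space xi) \<and> p \<noteq> q"
  then obtain a x b y where p: "p = L_class xi a x" "x \<in> std_simplex" and q: "q = L_class xi b y" "y \<in> std_simplex"
    by (auto simp: topspace_L_space)
  show "\<exists>U V. openin (L_space xi) U \<and> openin (L_space xi) V \<and> p \<in> U \<and> q \<in> V \<and> disjnt U V"
  proof (cases "x = y")
    case False
    have "continuous_map (prod_topology euclidean (top_of_set std_simplex)) (euclidean :: (real^'n) topology) snd"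
      using continuous_map_snd[of euclidean "top_of_set (std_simplex :: (real^'n) set)"]
      by (metis continuous_map_in_subtopology)
    then obtain h where h: "continuous_map (L_space xi) (euclidean :: (real^'n) topology) h"
      and h_eq: "\<And>p. p \<in> topspace (prod_topology euclidean (top_of_set std_simplex)) \<Longrightarrow> h ((\<lambda>(b, x). L_class xi b x) p) = snd p"
      by (rule quotient_map_lift_exists[OF quotient_map_L_class_id[of xi]]) (auto simp: L_class_eq_iff)
    have "h p = x" "h q = y"
      using h_eq[of "(a, x)"] h_eq[of "(b, y)"] p q by simp_all
    obtain U V where UV: "open U" "open V" "x \<in> U" "y \<in> V" "U \<inter> V = {}"
      using hausdorff[OF False] by blast
    show ?thesis
    proof (intro exI conjI)
      show "openin (L_space xi) {p \<in> topspace (L_space xi). h p \<in> U}" "openin (L_space xi) {p \<in> topspace (L_space xi). h p \<in> V}"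
        using h UV by (auto intro: openin_continuous_map_preimage)
    qed (use pq UV \<open>h p = x\<close> \<open>h q = y\<close> in \<open>auto simp: disjnt_def\<close>)
  next
    case True
    obtain j where "x $ j > 0"
      using std_simplex_pos_coordinate[OF p(2)] .
    then have in_chart: "p \<in> L_chart xi j" "q \<in> L_chart xi j"
      using p q True by (simp_all add: L_class_mem_chart_iff)
    have "Hausdorff_space (subtopology (L_space xi) (L_chart xi j))"
      using homeomorphic_Hausdorff_space[OF L_chart_homeomorphic_sphere_part[OF xi, of j]]
      by (simp add: Hausdorff_space_subtopology)
    moreover have "topspace (subtopology (L_space xi) (L_chart xi j)) = L_chart xi j"
      using openin_subset[OF openin_L_chart[of xi j]] by auto
    ultimately obtain U V where "openin (subtopology (L_space xi) (L_chart xi j)) U"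
      "openin (subtopology (L_space xi) (L_chart xi j)) V" "p \<in> U" "q \<in> V" "disjnt U V"
      using in_chart pq unfolding Hausdorff_space_def by metis
    then show ?thesis
      by (metis openin_L_chart openin_trans_full)
  qed
qed

lemma topological_manifold_L_space:
  fixes xi :: "'n::finite \<Rightarrow> int^'n"
  assumes n: "CARD('n) = n + 1" "n \<ge> 1" and xi: "hyper_characteristic xi"
  shows "topological_manifold (2 * n + 1) (L_space xi)"
  unfolding topological_manifold_def
proof (intro conjI ballI)
  show "Hausdorff_space (L_space xi)"
    using xi by (rule Hausdorff_L_space)
  show "second_countable (L_space xi)"
  proof (rule second_countable_finite_open_cover)
    show "topspace (L_space xi) = (\<Union>j\<in>UNIV. L_chart xi j)"
      by (rule topspace_L_space_charts)
    fix j
    show "second_countable (subtopology (L_space xi) (L_chart xi j))"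
      using homeomorphic_space_second_countability[OF L_chart_homeomorphic_sphere_part[OF xi, of j]]
        second_countable_top_of_set by blast
  qed (simp_all add: openin_L_chart)
  fix p assume "p \<in> topspace (L_space xi)"
  then obtain j where j: "p \<in> L_chart xi j"
    by (auto simp: topspace_L_space_charts)
  obtain V where V: "openin (Euclidean_space (2 * n + 1)) V"
    "top_of_set {z \<in> sphere (0 :: complex^'n) 1. z $ j \<noteq> 0} homeomorphic_space subtopology (Euclidean_space (2 * n + 1)) V"
    using sphere_nonzero_coordinate_chart[OF n] by blast
  have "subtopology (L_space xi) (L_chart xi j) homeomorphic_space subtopology (Euclidean_space (2 * n + 1)) V"
    using L_chart_homeomorphic_sphere_part[OF xi] V(2) by (rule homeomorphic_space_trans)
  then show "\<exists>U V. openin (L_space xi) U \<and> p \<in> U \<and> openin (Euclidean_space (2 * n + 1)) V \<and>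
        subtopology (L_space xi) U homeomorphic_space subtopology (Euclidean_space (2 * n + 1)) V"
    using openin_L_chart j V(1) by blast
qed


section \<open>Rank \<open>n\<close>\<close>

definition line_through :: "complex^'n \<Rightarrow> (complex^'n) set" where
  "line_through z = {c *s z | c. c \<noteq> 0}"

lemma line_through_eq_iff: "line_through z = line_through w \<longleftrightarrow> (\<exists>c. c \<noteq> 0 \<and> z = c *s w)"
proof
  assume "line_through z = line_through w"
  moreover have "z \<in> line_through z"
    unfolding line_through_def by (intro CollectI exI[of _ 1]) simp
  ultimately show "\<exists>c. c \<noteq> 0 \<and> z = c *s w"
    by (auto simp: line_through_def)
next
  assume "\<exists>c. c \<noteq> 0 \<and> z = c *s w"
  then obtain c where c: "c \<noteq> 0" "z = c *s w" by blast
  have "d *s z = (d * c) *s w" "d *s w = (d / c) *s z" for d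
    using c by simp_all
  moreover have "d * c \<noteq> 0" "d / c \<noteq> 0" if "d \<noteq> 0" for d
    using that c(1) by simp_all
  ultimately show "line_through z = line_through w"
    unfolding line_through_def by blast
qed

text \<open>The radial retraction onto the sphere moves points only within their lines, so the quotient map
  of the punctured space factors through it.\<close>

lemma quotient_map_sphere_projective:
  "quotient_map (top_of_set (sphere (0 :: complex^'n::finite) 1)) complex_projective_space line_through"
proof -
  let ?r = "\<lambda>z :: complex^'n. z /\<^sub>R norm z"
  have q: "quotient_map (top_of_set (- {0 :: complex^'n})) complex_projective_space line_through"
    unfolding complex_projective_space_def line_through_def by (rule quotient_map_quotient_topology)
  have r: "continuous_map (top_of_set (- {0})) (top_of_set (sphere 0 1)) ?r"
    by (auto simp: continuous_map_in_subtopology intro!: continuous_intros)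
  have incl: "continuous_map (top_of_set (sphere 0 1)) (top_of_set (- {0 :: complex^'n})) (\<lambda>z. z)"
    by (auto simp: continuous_map_in_subtopology)
  have "quotient_map (top_of_set (- {0 :: complex^'n})) complex_projective_space (line_through \<circ> ?r)"
  proof (rule quotient_map_eq[OF q])
    fix z :: "complex^'n" assume "z \<in> topspace (top_of_set (- {0}))"
    then have "z = complex_of_real (norm z) *s ?r z"
      unfolding vec_eq_iff vector_smult_component vector_scaleR_component scaleR_conv_of_real[where 'a = complex]
      by simp
    then show "line_through z = (line_through \<circ> ?r) z"
      using \<open>z \<in> _\<close> unfolding comp_def line_through_eq_iff by (intro exI[of _ "complex_of_real (norm z)"]) simp
  qed
  then show ?thesis
    using quotient_map_from_composition[OF r] continuous_map_compose[OF incl quotient_imp_continuous_map[OF q]]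
    by (simp add: comp_def)
qed

text \<open>Two unit vectors on a line differ by a rotation of all angles by a common \<open>s\<close>.\<close>

lemma line_through_polar_eq_iff:
  assumes xy: "x \<in> std_simplex" "y \<in> std_simplex"
  shows "line_through (polar a x) = line_through (polar b y) \<longleftrightarrow>
     x = y \<and> (\<exists>s. \<forall>i. x $ i \<noteq> 0 \<longrightarrow> a $ i - b $ i - s \<in> \<int>)"
proof -
  have rot: "cis (2 * pi * s) *s polar b y = polar (b + (\<chi> i. s)) y" for s
    by (simp add: polar_def vec_eq_iff cis_mult[symmetric] distrib_left)
  have "line_through (polar a x) = line_through (polar b y) \<longleftrightarrow> (\<exists>s. polar a x = cis (2 * pi * s) *s polar b y)"
    unfolding line_through_eq_iff
  proof
    assume "\<exists>c. c \<noteq> 0 \<and> polar a x = c *s polar b y"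
    then obtain c where c: "c \<noteq> 0" "polar a x = c *s polar b y" by blast
    have "norm (c *s polar b y) = cmod c * norm (polar b y)"
      by (simp add: norm_vec_def L2_set_def norm_mult power_mult_distrib sum_distrib_left[symmetric] real_sqrt_mult)
    then have "cmod c = 1"
      using norm_polar[OF xy(1), of a] norm_polar[OF xy(2), of b] c(2) by simp
    then have "c = cis (2 * pi * (Arg c / (2 * pi)))"
      using cis_Arg[OF c(1)] by (simp add: sgn_eq)
    then show "\<exists>s. polar a x = cis (2 * pi * s) *s polar b y"
      using c(2) by metis
  qed (use cis_neq_zero in blast)
  also have "\<dots> \<longleftrightarrow> x = y \<and> (\<exists>s. \<forall>i. x $ i \<noteq> 0 \<longrightarrow> a $ i - b $ i - s \<in> \<int>)"
    unfolding rot polar_eq_iff[OF xy] by (simp add: diff_diff_eq)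
  finally show ?thesis .
qed

lemma quotient_map_circle_sphere:
  "quotient_map (prod_topology (euclidean :: (real \<times> (real^'n::finite)) topology) (top_of_set std_simplex))
     (prod_topology (top_of_set (sphere (0 :: complex) 1)) (top_of_set (sphere (0 :: complex^'n) 1)))
     (\<lambda>((t, a), x). (cis (2 * pi * t), polar a x))"
proof (rule quotient_map_if_compact_surj)
  let ?K = "({-1..1} \<times> cbox (\<chi> i. -1) (\<chi> i. 1)) \<times> (std_simplex :: (real^'n) set)"
  let ?X = "prod_topology (euclidean :: (real \<times> (real^'n::finite)) topology) (top_of_set std_simplex)"
  have X: "?X = top_of_set (UNIV \<times> std_simplex)"
    by (simp add: prod_topology_subtopology subtopology_UNIV[symmetric] del: subtopology_UNIV)
  have cont: "continuous_on S (\<lambda>p :: (real \<times> (real^'n)) \<times> (real^'n). polar (snd (fst p)) (snd p))" for S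
    unfolding polar_def by (intro continuous_intros)
  show "continuous_map ?X (prod_topology (top_of_set (sphere (0 :: complex) 1)) (top_of_set (sphere (0 :: complex^'n) 1)))
     (\<lambda>((t, a), x). (cis (2 * pi * t), polar a x))"
    unfolding case_prod_unfold X
    by (intro continuous_map_pairedI)
      (auto simp: continuous_map_in_subtopology norm_polar cont intro!: continuous_intros)
  show "compactin ?X ?K"
    by (auto simp: compactin_Times compactin_subtopology compact_std_simplex compact_cbox compact_Times)
  show "(\<lambda>((t, a), x). (cis (2 * pi * t), polar a x)) ` ?K = topspace (prod_topology (top_of_set (sphere (0 :: complex) 1)) (top_of_set (sphere (0 :: complex^'n) 1)))"
  proof (intro equalityI subsetI)
    fix p assume p: "p \<in> topspace (prod_topology (top_of_set (sphere (0 :: complex) 1)) (top_of_set (sphere (0 :: complex^'n) 1)))"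
    obtain c z where cz: "p = (c, z)" by (metis surj_pair)
    with p have c: "cmod c = 1" and z: "z \<in> sphere 0 1" by auto
    obtain a x where ax: "x \<in> std_simplex" "a \<in> cbox (\<chi> i. -1) (\<chi> i. 1)" "z = polar a x"
      using sphere_polar[OF z] .
    define t where "t = Arg c / (2 * pi)"
    have "\<bar>Arg c\<bar> \<le> 2 * pi"
      using Arg_bounded[of c] pi_gt_zero by linarith
    then have "\<bar>t\<bar> \<le> 1" by (simp add: t_def)
    then have "t \<in> {-1..1}" by (simp add: abs_le_iff)
    moreover have "c = cis (2 * pi * t)"
      using cis_Arg[of c] c by (cases "c = 0") (simp_all add: t_def sgn_eq)
    ultimately show "p \<in> (\<lambda>((t, a), x). (cis (2 * pi * t), polar a x)) ` ?K"
      using ax cz by (intro image_eqI[of _ _ "((t, a), x)"]) auto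
  qed (auto simp: norm_polar)
qed (simp add: Hausdorff_space_prod_topology Hausdorff_space_subtopology)

text \<open>The direction of the parameter space that is mapped to zero is the simultaneous rotation of
  all coordinates, so it turns the sphere into projective space; the vector \<open>v\<close> that completes the
  \<open>xi i\<close> to a generating set of the lattice lies outside their span, so no isotropy group affects
  its coordinate \<open>t\<close>, which contributes the circle.\<close>

lemma L_homeomorphic_circle_projective:
  fixes xi :: "'n::finite \<Rightarrow> int^'n"
  assumes xi: "hyper_characteristic xi" and rank: "has_rank (int_vec.span (range xi)) n" "CARD('n) = n + 1"
  shows "L_space xi homeomorphic_space
    prod_topology (top_of_set (sphere (0::complex) 1)) (complex_projective_space :: (complex^'n) set topology)"
proof -
  obtain e :: "'n \<Rightarrow> real" and v where e: "\<And>i. e i = 1 \<or> e i = - 1"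
    and surj: "surj (\<lambda>(t::real, x::real^'n). t *\<^sub>R real_vec v + (\<Sum>i\<in>UNIV. (x $ i) *\<^sub>R (e i *\<^sub>R real_vec (xi i))))"
    and lattice: "\<And>t x. t *\<^sub>R real_vec v + (\<Sum>i\<in>UNIV. (x $ i) *\<^sub>R (e i *\<^sub>R real_vec (xi i))) \<in> range real_vec \<longleftrightarrow>
       t \<in> \<int> \<and> (\<exists>s. \<forall>i. x $ i - s \<in> \<int>)"
    using corank_one_parametrisation[OF xi rank] by blast
  define F where "F = (\<lambda>(t::real, x::real^'n). t *\<^sub>R real_vec v + (\<Sum>i\<in>UNIV. (x $ i) *\<^sub>R (e i *\<^sub>R real_vec (xi i))))"
  have "linear F"
    unfolding F_def
    by (rule linearI) (auto simp: algebra_simps sum.distrib scaleR_right.sum)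
  have e2: "e i * e i = 1" for i
    using e[of i] by auto
  have F_diff: "F p - F q = F (p - q)" for p q
    using \<open>linear F\<close> by (simp add: linear_diff)
  \<comment> \<open>Subtracting a combination of the \<open>xi i\<close> amounts to changing coordinates of the parameter.\<close>
  have isotropy_F: "F (t, a) \<in> isotropy xi x \<longleftrightarrow> t \<in> \<int> \<and> (\<exists>s. \<forall>i. x $ i \<noteq> 0 \<longrightarrow> a $ i - s \<in> \<int>)" for t a x
  proof -
    have F_lattice: "F (t, b) \<in> range real_vec \<longleftrightarrow> t \<in> \<int> \<and> (\<exists>s. \<forall>i. b $ i - s \<in> \<int>)" for b
      unfolding F_def prod.case by (rule lattice)
    have shift: "F (t, a) - (\<Sum>i\<in>UNIV. c i *\<^sub>R real_vec (xi i)) = F (t, a - (\<chi> i. c i * e i))" for c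
      by (simp add: F_def algebra_simps sum_subtractf mult.assoc e2)
    have "F (t, a) \<in> isotropy xi x \<longleftrightarrow>
        t \<in> \<int> \<and> (\<exists>c s. (\<forall>i. x $ i \<noteq> 0 \<longrightarrow> c i = 0) \<and> (\<forall>i. a $ i - c i * e i - s \<in> \<int>))"
      unfolding isotropy_def mem_Collect_eq shift F_lattice by auto
    also have "(\<exists>c s. (\<forall>i. x $ i \<noteq> 0 \<longrightarrow> c i = 0) \<and> (\<forall>i. a $ i - c i * e i - s \<in> \<int>)) \<longleftrightarrow>
        (\<exists>s. \<forall>i. x $ i \<noteq> 0 \<longrightarrow> a $ i - s \<in> \<int>)"
    proof
      assume "\<exists>c s. (\<forall>i. x $ i \<noteq> 0 \<longrightarrow> c i = 0) \<and> (\<forall>i. a $ i - c i * e i - s \<in> \<int>)"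
      then obtain c s where cs: "\<forall>i. x $ i \<noteq> 0 \<longrightarrow> c i = 0" "\<forall>i. a $ i - c i * e i - s \<in> \<int>" by blast
      have "a $ i - s \<in> \<int>" if "x $ i \<noteq> 0" for i
        using cs(2)[rule_format, of i] cs(1) that by simp
      then show "\<exists>s. \<forall>i. x $ i \<noteq> 0 \<longrightarrow> a $ i - s \<in> \<int>" by blast
    next
      assume "\<exists>s. \<forall>i. x $ i \<noteq> 0 \<longrightarrow> a $ i - s \<in> \<int>"
      then obtain s where s: "\<forall>i. x $ i \<noteq> 0 \<longrightarrow> a $ i - s \<in> \<int>" by blast
      define c where "c i = (if x $ i = 0 then (a $ i - s) * e i else 0)" for i
      have "a $ i - c i * e i - s \<in> \<int>" for i
        using s by (cases "x $ i = 0") (simp_all add: c_def mult.assoc e2)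
      moreover have "\<forall>i. x $ i \<noteq> 0 \<longrightarrow> c i = 0" by (simp add: c_def)
      ultimately show "\<exists>c s. (\<forall>i. x $ i \<noteq> 0 \<longrightarrow> c i = 0) \<and> (\<forall>i. a $ i - c i * e i - s \<in> \<int>)" by blast
    qed
    finally show ?thesis .
  qed
  let ?X = "prod_topology (euclidean :: (real \<times> (real^'n)) topology) (top_of_set (std_simplex :: (real^'n) set))"
  let ?S1 = "top_of_set (sphere (0::complex) 1)"
  let ?g = "(\<lambda>(c, z). (c, line_through z)) \<circ> (\<lambda>((t, a), x). (cis (2 * pi * t), polar a x))"
  have f: "quotient_map ?X (L_space xi) (\<lambda>(p, x). L_class xi (F p) x)"
    using quotient_map_L_class[OF \<open>linear F\<close>] surj by (simp add: F_def)
  have "quotient_map (prod_topology ?S1 (top_of_set (sphere (0 :: complex^'n) 1)))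
      (prod_topology ?S1 complex_projective_space) (\<lambda>(c, z). (c, line_through z))"
    by (rule quotient_map_prod_right[OF _ _ quotient_map_sphere_projective])
      (simp_all add: compact_imp_locally_compact_space compact_space_subtopology Hausdorff_space_subtopology)
  then have g: "quotient_map ?X (prod_topology ?S1 complex_projective_space) ?g"
    by (rule quotient_map_compose[OF quotient_map_circle_sphere])
  show ?thesis
  proof (rule homeomorphic_quotients[OF f g])
    fix p q assume pq: "p \<in> topspace ?X" "q \<in> topspace ?X"
    obtain t a x t' b y where pq_eq: "p = ((t, a), x)" "q = ((t', b), y)" by (metis surj_pair)
    with pq have xy: "x \<in> std_simplex" "y \<in> std_simplex" by auto
    show "(case p of (p, x) \<Rightarrow> L_class xi (F p) x) = (case q of (p, x) \<Rightarrow> L_class xi (F p) x) \<longleftrightarrow> ?g p = ?g q"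
      unfolding pq_eq by (simp add: L_class_eq_iff[OF xy] line_through_polar_eq_iff[OF xy] F_diff isotropy_F cis_2pi_eq_iff conj_ac)
  qed
qed

lemma is_basis_imp_lattice_basis:
  fixes xi :: "'n::finite \<Rightarrow> int^'n"
  assumes "is_basis (range xi)" "has_rank (int_vec.span (range xi)) CARD('n)"
  shows "lattice_basis xi"
proof -
  have "\<exists>m. w = (\<Sum>i\<in>UNIV. m i *s xi i)" for w
  proof (rule int_span_family[of UNIV w xi])
    show "w \<in> int_vec.span (range xi)"
      using assms(1) by (simp add: is_basis_def)
  qed auto
  then show ?thesis
    using full_rank_independent[OF assms(2)] by (simp add: lattice_basis_def)
qed

theorem proposition2p3:
  fixes n :: nat and xi :: "'n::finite \<Rightarrow> int^'n"
  assumes "n \<ge> 1" and "CARD('n) = n + 1" and "hyper_characteristic xi"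
  shows "topological_manifold (2 * n + 1) (L_space xi)
    \<and> continuous_map (prod_topology torus (L_space xi)) (L_space xi) (\<lambda>(t, p). torus_action xi t p)
    \<and> faithful_action torus_group (topspace (L_space xi)) (torus_action xi)
    \<and> (has_rank (int_vec.span (range xi)) n \<longrightarrow>
        L_space xi homeomorphic_space
          prod_topology (top_of_set (sphere (0::complex) 1))
            (complex_projective_space :: (complex^'n) set topology))
    \<and> (has_rank (int_vec.span (range xi)) (n + 1) \<longrightarrow>
        L_space xi homeomorphic_space
          orbit_space (quotient_lattice xi) (top_of_set (sphere (0::complex^'n) 1)) (sphere_action xi)
        \<and> (is_basis (range xi) \<longrightarrow>
             L_space xi homeomorphic_space top_of_set (sphere (0::complex^'n) 1)))"
proof (intro conjI impI)
  show "topological_manifold (2 * n + 1) (L_space xi)"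
    using assms by (intro topological_manifold_L_space)
  show "continuous_map (prod_topology torus (L_space xi)) (L_space xi) (\<lambda>(t, p). torus_action xi t p)"
    by (rule continuous_torus_action)
  show "faithful_action torus_group (topspace (L_space xi)) (torus_action xi)"
    by (rule faithful_torus_action)
next
  assume "has_rank (int_vec.span (range xi)) n"
  then show "L_space xi homeomorphic_space
      prod_topology (top_of_set (sphere (0::complex) 1)) (complex_projective_space :: (complex^'n) set topology)"
    using assms by (intro L_homeomorphic_circle_projective)
next
  assume "has_rank (int_vec.span (range xi)) (n + 1)"
  then have rank: "has_rank (int_vec.span (range xi)) CARD('n)"
    by (simp add: assms(2))
  then show "L_space xi homeomorphic_space
      orbit_space (quotient_lattice xi) (top_of_set (sphere (0::complex^'n) 1)) (sphere_action xi)"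
    by (intro L_homeomorphic_sphere_orbit_space full_rank_independent)
  assume "is_basis (range xi)"
  then show "L_space xi homeomorphic_space top_of_set (sphere (0::complex^'n) 1)"
    using rank by (intro L_homeomorphic_sphere_if_basis is_basis_imp_lattice_basis)
qed

end
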